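(* Let $t\ge1$ be an integer and $g=2t+1$. Let $\omega\in\mathcal{DD}_{(g)}$ be a doubled distinct $g$-core, let $\mathbf{v}\in\mathbb{Z}^t$ be its $V_{g,t}$-coding, and set $r_i=v_i-g/2$ for $1\le i\le t$. Then $$|\omega| = \frac{1}{g}\sum_{i=1}^{t} r_i^2-\frac{(g-2)\lfloor g/2\rfloor}{12}.$$ Moreover, setting $\alpha_i(\omega)=\#\{s\in\omega\mid h_s=g-i,\ \varepsilon_s=1\}$, for any field $F$ and any function $\tau:\mathbb{Z}\to F^{\times}$, $$\prod_{s\in\omega}\frac{\tau(h_s-\varepsilon_s g)}{\tau(h_s)}=\prod_{i=1}^{g-1}\left(\frac{\tau(-i)}{\tau(i)}\right)^{\alpha_i(\omega)}\prod_{1\le i<j\le t} \frac{\tau(r_i-r_j)}{\tau(j-i)}\, \frac{\tau(r_i+r_j)}{\tau(g-i-j)}.$$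
   Context: For a partition $\lambda$, $h_s$ is the hook length of a box $s$, $d_\lambda=\max\{s:\lambda_s\ge s\}$, and $\varepsilon_s=-1$ if $s$ is strictly below the main diagonal of the Ferrers diagram (English convention), $\varepsilon_s=1$ otherwise. A $g$-core is a partition with no hook length divisible by $g$. $\mathcal{DD}$ is the set of partitions with $\lambda_i=\lambda'_i+1$ for $1\le i\le d_\lambda$ ($\lambda'$ the conjugate; the empty partition included), and $\mathcal{DD}_{(g)}$ is the set of $g$-cores in $\mathcal{DD}$. Word of a partition: $\psi(\lambda)=(c_k)_{k\in\mathbb{Z}}\in\{0,1\}^{\mathbb{Z}}$ encodes the border of the Ferrers diagram read from South-West to North-East ($0$ vertical step, $1$ horizontal step), indexed so that $\#\{k\le -1: c_k=1\}=\#\{k\ge 0: c_k=0\}$; equivalently $c_k=0$ iff $k=\lambda_i-i$ for some $i\ge1$ (with $\lambda_i=0$ beyond the length). $V_{g,t}$-coding: for $i\in\{0,\dots,g-1\}$ let $\beta_i=\max\{(k+1)g+i\mid k\in\mathbb{Z},\ c_{kg+i}=0\}$; the $V_{g,t}$-coding is $\mathbf{v}=(v_1>\dots>v_t)$, the $t$ largest of the distinct integers $\beta_0,\dots,\beta_{g-1}$ in decreasing order. (Here the $r_i$ are half-integers, and $r_i\pm r_j$ are integers.) *)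

theory Defs
  imports Complex_Main
begin

section \<open>Partitions and their Ferrers diagrams\<close>

definition is_partition :: "nat list \<Rightarrow> bool" where
  "is_partition lam \<longleftrightarrow> sorted_wrt (\<ge>) lam \<and> 0 \<notin> set lam"

text \<open>Parts are numbered from 1. Outside \<open>{1..length lam}\<close>, in particular at the junk
  index 0, the value is 0.\<close>

definition prt :: "nat list \<Rightarrow> nat \<Rightarrow> nat" where
  "prt lam i = (if 1 \<le> i \<and> i \<le> length lam then lam ! (i - 1) else 0)"

definition conj_prt :: "nat list \<Rightarrow> nat \<Rightarrow> nat" where
  "conj_prt lam j = card {i \<in> {1..length lam}. j \<le> prt lam i}"

text \<open>Boxes are (row, column) in English convention, both coordinates starting at 1.\<close>

definition boxes :: "nat list \<Rightarrow> (nat \<times> nat) set" where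
  "boxes lam = {(i, j). 1 \<le> i \<and> i \<le> length lam \<and> 1 \<le> j \<and> j \<le> prt lam i}"

text \<open>Arm plus leg plus one.\<close>

definition hook :: "nat list \<Rightarrow> nat \<times> nat \<Rightarrow> int" where
  "hook lam = (\<lambda>(i, j). (int (prt lam i) - int j) + (int (conj_prt lam j) - int i) + 1)"

definition eps :: "nat \<times> nat \<Rightarrow> int" where
  "eps = (\<lambda>(i, j). if j < i then - 1 else 1)"

text \<open>The set contains 0 because \<open>prt lam 0 = 0\<close>, so the empty partition has value 0.\<close>

definition durfee :: "nat list \<Rightarrow> nat" where
  "durfee lam = Max {s. s \<le> prt lam s}"

definition is_core :: "nat \<Rightarrow> nat list \<Rightarrow> bool" where
  "is_core g lam \<longleftrightarrow> is_partition lam \<and> (\<forall>s \<in> boxes lam. \<not> int g dvd hook lam s)"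

definition doubled_distinct :: "nat list set" where
  "doubled_distinct =
     {lam. is_partition lam \<and> (\<forall>i \<in> {1..durfee lam}. prt lam i = conj_prt lam i + 1)}"

definition doubled_distinct_cores :: "nat \<Rightarrow> nat list set" where
  "doubled_distinct_cores g = {lam \<in> doubled_distinct. is_core g lam}"

definition alpha :: "nat \<Rightarrow> nat list \<Rightarrow> nat \<Rightarrow> nat" where
  "alpha g lam i = card {s \<in> boxes lam. hook lam s = int g - int i \<and> eps s = 1}"

section \<open>Words and codings\<close>

text \<open>The border of the diagram read from South-West to North-East, with 0 for a vertical and
  1 for a horizontal step. The vertical step at the end of row \<open>i\<close> (rows beyond the length
  included) has index \<open>prt lam i - i\<close>; \<open>border_word_balanced\<close> below confirms that this is the
  usual normalisation of the indexing.\<close>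

definition border_word :: "nat list \<Rightarrow> int \<Rightarrow> nat" where
  "border_word lam k = (if \<exists>i\<ge>1. k = int (prt lam i) - int i then 0 else 1)"

lemma prt_antimono:
  assumes "is_partition lam" "1 \<le> i" "i \<le> j"
  shows "prt lam j \<le> prt lam i"
proof (cases "i < j \<and> j \<le> length lam")
  case True
  then have "lam ! (j - 1) \<le> lam ! (i - 1)"
    using assms sorted_wrt_nth_less[of "(\<ge>)" lam "i - 1" "j - 1"]
    by (auto simp: is_partition_def)
  with True assms show ?thesis by (auto simp: prt_def)
next
  case False
  then show ?thesis using assms by (auto simp: prt_def)
qed

lemma border_word_balanced:
  assumes "is_partition lam"
  shows "card {k. k \<le> - 1 \<and> border_word lam k = 1} = card {k. k \<ge> 0 \<and> border_word lam k = 0}"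
proof -
  define n where "n = length lam"
  define f where "f = (\<lambda>i. int (prt lam i) - int i)"
  have f_less: "f j < f i" if "1 \<le> i" "i < j" for i j
    using prt_antimono[OF assms that(1), of j] that by (auto simp: f_def)
  have inj: "inj_on f {1..n}"
    by (intro inj_onI) (metis atLeastAtMost_iff f_less linorder_neqE_nat order_less_irrefl)
  have beyond: "f i = - int i" if "i > n" for i
    using that by (auto simp: f_def prt_def n_def)
  have lower: "f i \<ge> - int n" if "i \<in> {1..n}" for i
    using that by (auto simp: f_def)
  have zero: "border_word lam k = 0 \<longleftrightarrow> k \<in> f ` {1..n}" if "k \<ge> - int n" for k
  proof -
    have "i \<le> n" if "k = f i" for i
      using beyond[of i] that \<open>k \<ge> - int n\<close> by (cases "i > n") auto
    then show ?thesis by (auto simp: border_word_def f_def)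
  qed
  have zero': "border_word lam k = 0" if "k < - int n" for k
  proof -
    have "k = f (nat (- k))" "nat (- k) \<ge> 1" using that beyond[of "nat (- k)"] by auto
    then show ?thesis by (auto simp: border_word_def f_def)
  qed
  let ?F = "f ` {1..n}"
  let ?P = "{k \<in> ?F. k \<ge> 0}" and ?N = "{k \<in> ?F. k < 0}"
  have P: "{k. k \<ge> 0 \<and> border_word lam k = 0} = ?P" using zero by auto
  have N: "{k. k \<le> - 1 \<and> border_word lam k = 1} = {- int n..- 1} - ?N"
  proof (intro set_eqI)
    fix k
    have "border_word lam k = 1 \<longleftrightarrow> border_word lam k \<noteq> 0" by (auto simp: border_word_def)
    then show "k \<in> {k. k \<le> - 1 \<and> border_word lam k = 1} \<longleftrightarrow> k \<in> {- int n..- 1} - ?N"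
      using zero[of k] zero'[of k] by (cases "k < - int n") auto
  qed
  have "card ?P + card ?N = card (?P \<union> ?N)" by (subst card_Un_disjoint) auto
  also have "?P \<union> ?N = ?F" by auto
  also have "card ?F = n" using inj by (simp add: card_image)
  finally have sum: "card ?P + card ?N = n" .
  have "?N \<subseteq> {- int n..- 1}" using lower by auto
  then have "card ({- int n..- 1} - ?N) = card {- int n..- 1} - card ?N"
    by (intro card_Diff_subset) auto
  with P N sum show ?thesis by simp
qed

text \<open>The maximum is written with \<open>GREATEST\<close> because the set, although bounded above, is infinite.\<close>

definition beta :: "nat \<Rightarrow> nat list \<Rightarrow> nat \<Rightarrow> int" where
  "beta g lam i =
     (GREATEST x. \<exists>k::int. x = (k + 1) * int g + int i \<and> border_word lam (k * int g + int i) = 0)"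

text \<open>The entry \<open>v\<^sub>i\<close> of the coding is \<open>V_coding g t lam ! (i - 1)\<close>.\<close>

definition V_coding :: "nat \<Rightarrow> nat \<Rightarrow> nat list \<Rightarrow> int list" where
  "V_coding g t lam = take t (rev (sorted_list_of_set (beta g lam ` {0..<g})))"

text \<open>Evaluates a function on the integers at a real number, which is meant to be an integer.
  The next lemma shows that no rounding occurs at sums and differences of \<open>v\<^sub>i - g / 2\<close>.\<close>

definition at_int :: "(int \<Rightarrow> 'a) \<Rightarrow> real \<Rightarrow> 'a" where
  "at_int f x = f \<lfloor>x\<rfloor>"

lemma at_int_simps:
  "at_int f ((real_of_int a - real g / 2) - (real_of_int b - real g / 2)) = f (a - b)"
  "at_int f ((real_of_int a - real g / 2) + (real_of_int b - real g / 2)) = f (a + b - int g)"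
proof -
  have "(real_of_int a - real g / 2) - (real_of_int b - real g / 2) = real_of_int (a - b)"
    "(real_of_int a - real g / 2) + (real_of_int b - real g / 2) = real_of_int (a + b - int g)"
    by (simp_all add: field_simps)
  then show "at_int f ((real_of_int a - real g / 2) - (real_of_int b - real g / 2)) = f (a - b)"
    "at_int f ((real_of_int a - real g / 2) + (real_of_int b - real g / 2)) = f (a + b - int g)"
    by (simp_all only: at_int_def floor_of_int)
qed

end

theory Submission
  imports Defs
begin

text \<open>Let \<open>S\<close> be the set of indices of the letters 0 in the word. Boxes correspond to pairs
  \<open>a < b\<close> with \<open>a \<notin> S\<close>, \<open>b \<in> S\<close> and hook length \<open>b - a\<close>. For a doubled distinct partition
  \<open>0 \<notin> S\<close>, and of \<open>k\<close> and \<open>- k\<close> exactly one is in \<open>S\<close> when \<open>k \<noteq> 0\<close>, so \<open>S\<close> is determined by the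
  set \<open>B\<close> of its positive elements, and \<open>eps\<close> is the sign of \<open>a + b\<close>
  (\<open>1\<close> if \<open>a + b = 0\<close>). For a core, \<open>S\<close> is closed
  under subtracting \<open>g\<close>, the numbers \<open>\<beta>\<close> form a set symmetric under \<open>x \<mapsto> g - x\<close> apart from
  \<open>0\<close>, and the coding consists of those exceeding \<open>g / 2\<close>. Both identities follow by induction on
  \<open>B\<close>: removing the largest element \<open>b\<close> replaces \<open>b + g\<close> by \<open>max b (g - b)\<close> in the coding, that
  is, \<open>r\<close> by \<open>\<bar>r - g\<bar>\<close>, and the product over the boxes lost telescopes.\<close>

section \<open>Symmetric sets of beads\<close>

text \<open>For \<open>B\<close> consisting of positive integers, the Maya diagram that is
  antisymmetric about 0 and has \<open>B\<close> as its positive beads; position 0 is a gap.\<close>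

definition maya :: "int set \<Rightarrow> int set" where
  "maya B = B \<union> {k. k < 0 \<and> - k \<notin> B}"

text \<open>The bound \<open>- b \<le> a\<close> selects the partners of \<open>b\<close> with
  \<open>a + b \<ge> 0\<close>, the boxes with \<open>eps\<close> equal to 1. For the largest bead
  these are all gaps below \<open>b\<close>, since every integer below \<open>- b\<close> is then a
  bead.\<close>

definition row :: "int set \<Rightarrow> int \<Rightarrow> int set" where
  "row B b = {a. - b \<le> a \<and> a < b \<and> a \<notin> maya B}"

text \<open>For a core these are the numbers \<open>\<beta>\<^sub>i\<close>.\<close>

definition edge :: "int \<Rightarrow> int set \<Rightarrow> int set" where
  "edge g B = {x. x - g \<in> maya B \<and> x \<notin> maya B}"

definition upper :: "int \<Rightarrow> int set \<Rightarrow> int set" where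
  "upper g B = {x \<in> edge g B. g < 2 * x}"

definition core_beads :: "int \<Rightarrow> int set \<Rightarrow> bool" where
  "core_beads g B \<longleftrightarrow> (\<forall>k \<in> maya B. k - g \<in> maya B)"

lemma maya_pos: "0 < k \<Longrightarrow> k \<in> maya B \<longleftrightarrow> k \<in> B"
  by (auto simp: maya_def)

lemma zero_notin_maya: "B \<subseteq> {0<..} \<Longrightarrow> 0 \<notin> maya B"
  by (auto simp: maya_def)

lemma uminus_in_maya_iff:
  assumes "B \<subseteq> {0<..}" "k \<noteq> 0"
  shows "- k \<in> maya B \<longleftrightarrow> k \<notin> maya B"
  using assms by (cases "k > 0") (auto simp: maya_def)

lemma core_beadsD: "core_beads g B \<Longrightarrow> k \<in> maya B \<Longrightarrow> k - g \<in> maya B"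
  by (auto simp: core_beads_def)

lemma core_beads_add: "core_beads g B \<Longrightarrow> k \<notin> maya B \<Longrightarrow> k + g \<notin> maya B"
  using core_beadsD[of g B "k + g"] by auto

text \<open>Negation exchanges beads and gaps away from 0, so the pair bead \<open>x - g\<close>,
  gap \<open>x\<close> turns into bead \<open>- x\<close>, gap \<open>g - x\<close>. The value
  \<open>x = g\<close> cannot occur because 0 is a gap.\<close>

lemma edge_reflect:
  assumes "B \<subseteq> {0<..}" "x \<in> edge g B" "x \<noteq> 0"
  shows "g - x \<in> edge g B"
proof -
  have "x \<noteq> g" using assms zero_notin_maya by (auto simp: edge_def)
  then show ?thesis
    using assms uminus_in_maya_iff[of B x] uminus_in_maya_iff[of B "x - g"] by (auto simp: edge_def)
qed

text \<open>Since 0 is a gap of a core, so is \<open>g\<close>, and antisymmetry makes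
  \<open>- g\<close> a bead.\<close>

lemma zero_in_edge:
  assumes "B \<subseteq> {0<..}" "core_beads g B" "0 < g"
  shows "0 \<in> edge g B"
proof -
  have "0 \<notin> maya B" using assms zero_notin_maya by blast
  then show ?thesis
    using core_beads_add[OF assms(2), of 0] uminus_in_maya_iff[OF assms(1), of g] assms(3)
    by (auto simp: edge_def)
qed

lemma edge_bounds:
  assumes "B \<subseteq> {0<..N}" "0 \<le> N" "x \<in> edge g B"
  shows "- N \<le> x" "x \<le> N + g"
  using assms by (auto simp: edge_def maya_def)

lemma finite_edge:
  assumes "finite B" "B \<subseteq> {0<..}"
  shows "finite (edge g B)"
proof -
  define N where "N = Max (insert 0 B)"
  have "B \<subseteq> {0<..N}" "0 \<le> N" using assms by (auto simp: N_def)
  then have "edge g B \<subseteq> {- N..N + g}" using edge_bounds[of B N] by fastforce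
  then show ?thesis by (rule finite_subset) auto
qed

lemma finite_upper: "finite B \<Longrightarrow> B \<subseteq> {0<..} \<Longrightarrow> finite (upper g B)"
  using finite_edge by (auto simp: upper_def)

text \<open>For odd \<open>g\<close> the reflection \<open>x \<mapsto> g - x\<close> has no fixed
  point, so each nonzero edge is either above \<open>g / 2\<close> or the mirror image of one that
  is.\<close>

lemma edge_eq_upper:
  assumes "B \<subseteq> {0<..}" "core_beads g B" "0 < g" "odd g"
  shows "edge g B = insert 0 (upper g B \<union> (\<lambda>x. g - x) ` upper g B)" (is "_ = ?R")
proof (rule set_eqI)
  fix x
  show "x \<in> edge g B \<longleftrightarrow> x \<in> ?R"
  proof (cases "x = 0")
    case True
    then show ?thesis using zero_in_edge[OF assms(1-3)] by simp
  next
    case False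
    have "2 * x \<noteq> g" using assms(4) by auto
    moreover have "x \<in> (\<lambda>x. g - x) ` upper g B \<longleftrightarrow> g - x \<in> upper g B"
      by (auto intro: image_eqI[of _ _ "g - x"])
    moreover have "x \<in> edge g B" if "g - x \<in> upper g B"
      using edge_reflect[OF assms(1), of "g - x" g] that assms(1,3) False
      by (cases "g = x") (use zero_in_edge[OF assms(1-3)] in \<open>auto simp: upper_def\<close>)
    moreover have "g - x \<in> edge g B" if "x \<in> edge g B"
      using edge_reflect[OF assms(1) that False] .
    ultimately show ?thesis using False by (auto simp: upper_def)
  qed
qed

lemma finite_row: "finite (row B b)"
  by (rule finite_subset[of _ "{- b..<b}"]) (auto simp: row_def)

section \<open>One row of hooks\<close>

text \<open>To be applied to a row \<open>X\<close> and its translate \<open>Y\<close>, where only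
  the two differences matter. Cross-multiplication keeps the identity free of division.\<close>

lemma prod_exchange:
  fixes f :: "'b \<Rightarrow> 'a :: comm_monoid_mult"
  assumes "finite X" "finite Y"
  shows "prod f Y * prod f (X - Y) = prod f X * prod f (Y - X)"
proof -
  have "prod f Y * prod f (X - Y) = prod f (Y \<union> (X - Y))"
    using assms by (subst prod.union_disjoint) auto
  also have "Y \<union> (X - Y) = X \<union> (Y - X)" by auto
  also have "prod f \<dots> = prod f X * prod f (Y - X)"
    using assms by (subst prod.union_disjoint) auto
  finally show ?thesis .
qed

locale top_bead =
  fixes g b :: int and B :: "int set"
  assumes pos: "B \<subseteq> {0<..}" and fin: "finite B" and top: "b \<in> B" "\<And>x. x \<in> B \<Longrightarrow> x \<le> b"
    and core: "core_beads g B" and g_pos: "0 < g" and g_odd: "odd g"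
begin

abbreviation "M \<equiv> maya B"

text \<open>The gap \<open>b - g + i\<close> pairs with \<open>b\<close> to a hook of length
  \<open>g - i\<close>, so this set records the contribution of \<open>b\<close> to the numbers
  \<open>alpha\<close>.\<close>

definition "steps = {i \<in> {1..g - 1}. b - g + i \<in> row B b}"

lemma b_pos: "0 < b" using pos top by auto

lemma above: "b < x \<Longrightarrow> x \<notin> M"
  using top(2)[of x] b_pos by (auto simp: maya_def)

lemma below: "x < - b \<Longrightarrow> x \<in> M"
  using above[of "- x"] uminus_in_maya_iff[OF pos, of x] b_pos by auto

lemma b_in: "b \<in> M" using top by (auto simp: maya_def)

lemma minus_b_notin: "- b \<notin> M" using b_in uminus_in_maya_iff[OF pos, of b] b_pos by auto

lemma zero_notin: "0 \<notin> M" by (rule zero_notin_maya[OF pos])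

lemma row_iff: "a \<in> row B b \<longleftrightarrow> a < b \<and> a \<notin> M"
  using below[of a] by (cases "- b \<le> a") (auto simp: row_def)

lemma edge_iff: "x \<in> edge g B \<longleftrightarrow> x - g \<in> M \<and> x \<notin> M"
  by (simp add: edge_def)

lemma edge_special: "0 \<in> edge g B" "- b \<in> edge g B" "b + g \<in> edge g B"
  using zero_in_edge[OF pos core g_pos] minus_b_notin below[of "- b - g"] above[of "b + g"] b_in g_pos
  by (auto simp: edge_iff)

lemma edge_le: "x \<in> edge g B \<Longrightarrow> x \<le> b + g"
  using above[of "x - g"] by (fastforce simp: edge_iff)

text \<open>This and the next three lemmas compare the row with its translates by \<open>g\<close>.
  Where a translate fails to continue downwards, a gap sits \<open>g\<close> above a bead, which is
  an edge; at the top, the gaps within distance \<open>g\<close> of \<open>b\<close> are pushed past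
  \<open>b\<close>.\<close>

lemma row_minus_shift: "row B b - (\<lambda>a. a + g) ` row B b = {y \<in> edge g B. y < b}"
proof (rule set_eqI)
  fix x
  have "x \<in> (\<lambda>a. a + g) ` row B b \<longleftrightarrow> x - g \<in> row B b"
    by (auto intro: image_eqI[of _ _ "x - g"])
  then show "x \<in> row B b - (\<lambda>a. a + g) ` row B b \<longleftrightarrow> x \<in> {y \<in> edge g B. y < b}"
    using g_pos by (auto simp: row_iff edge_iff)
qed

lemma shift_minus_row: "(\<lambda>a. a + g) ` row B b - row B b = (\<lambda>i. b + i) ` steps"
proof (rule set_eqI)
  fix x
  have 1: "x \<in> (\<lambda>a. a + g) ` row B b \<longleftrightarrow> x - g \<in> row B b"
    by (auto intro: image_eqI[of _ _ "x - g"])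
  have 2: "x \<in> (\<lambda>i. b + i) ` steps \<longleftrightarrow> x - b \<in> steps"
    by (auto intro: image_eqI[of _ _ "x - b"])
  \<comment> \<open>The core condition makes \<open>b - g\<close> a bead, so no translated gap lands
    on \<open>b\<close> itself.\<close>
  have "x \<noteq> b" if "x - g \<notin> M" using that b_in core_beadsD[OF core] by auto
  then show "x \<in> (\<lambda>a. a + g) ` row B b - row B b \<longleftrightarrow> x \<in> (\<lambda>i. b + i) ` steps"
    unfolding Diff_iff 1 2 using core_beads_add[OF core, of "x - g"] above[of x] g_pos
    by (auto simp: row_iff steps_def algebra_simps)
qed

lemma row_minus_unshift: "row B b - (\<lambda>a. a - g) ` row B b = (\<lambda>i. b - g + i) ` steps"
proof (rule set_eqI)
  fix x
  have 1: "x \<in> (\<lambda>a. a - g) ` row B b \<longleftrightarrow> x + g \<in> row B b"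
    by (auto intro: image_eqI[of _ _ "x + g"])
  have 2: "x \<in> (\<lambda>i. b - g + i) ` steps \<longleftrightarrow> x - b + g \<in> steps"
    by (auto intro: image_eqI[of _ _ "x - b + g"])
  have "x + g \<noteq> b" if "x \<notin> M" using that b_in core_beadsD[OF core, of b] by auto
  then show "x \<in> row B b - (\<lambda>a. a - g) ` row B b \<longleftrightarrow> x \<in> (\<lambda>i. b - g + i) ` steps"
    unfolding Diff_iff 1 2 using core_beads_add[OF core, of x] g_pos
    by (auto simp: row_iff steps_def)
qed

lemma unshift_minus_row: "(\<lambda>a. a - g) ` row B b - row B b = (\<lambda>y. y - g) ` {y \<in> edge g B. y < b}"
proof (rule set_eqI)
  fix x
  have 1: "x \<in> (\<lambda>a. a - g) ` row B b \<longleftrightarrow> x + g \<in> row B b"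
    by (auto intro: image_eqI[of _ _ "x + g"])
  have 2: "x \<in> (\<lambda>y. y - g) ` {y \<in> edge g B. y < b} \<longleftrightarrow> x + g \<in> {y \<in> edge g B. y < b}"
    by (auto intro: image_eqI[of _ _ "x + g"])
  show "x \<in> (\<lambda>a. a - g) ` row B b - row B b \<longleftrightarrow> x \<in> (\<lambda>y. y - g) ` {y \<in> edge g B. y < b}"
    unfolding Diff_iff 1 2 using g_pos by (auto simp: row_iff edge_iff)
qed

text \<open>Every position \<open>b + i\<close> with \<open>i > 0\<close> is a gap, so for
  \<open>0 < i < g\<close> it is an edge exactly if \<open>b - g + i\<close> is a bead, that is, if
  \<open>i\<close> is not in \<open>steps\<close>.\<close>

lemma edge_above: "{y \<in> edge g B - {0, - b, b + g}. \<not> y < b} = (\<lambda>i. b + i) ` ({1..g - 1} - steps)"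
proof (rule set_eqI)
  fix x
  have 2: "x \<in> (\<lambda>i. b + i) ` ({1..g - 1} - steps) \<longleftrightarrow> x - b \<in> {1..g - 1} - steps"
    by (auto intro: image_eqI[of _ _ "x - b"])
  show "x \<in> {y \<in> edge g B - {0, - b, b + g}. \<not> y < b} \<longleftrightarrow> x \<in> (\<lambda>i. b + i) ` ({1..g - 1} - steps)"
  proof (cases "b < x \<and> x < b + g")
    case True
    then show ?thesis
      unfolding 2 using b_pos above[of x] by (auto simp: edge_iff steps_def row_iff algebra_simps)
  next
    case False
    have "x \<noteq> b" if "x \<in> edge g B" using that b_in by (auto simp: edge_iff)
    with False show ?thesis unfolding 2 using edge_le[of x] by auto
  qed
qed

text \<open>Shifting the row by \<open>g\<close> in either direction changes it only near its two ends, so both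
  products telescope. The entries of \<open>edge g B\<close> above \<open>b\<close> occur with the wrong sign; these are
  exactly the complement of \<open>steps\<close>, whence the factors with argument \<open>- i\<close>.\<close>

lemma row_prod:
  fixes \<tau> :: "int \<Rightarrow> 'a :: field"
  assumes nz: "\<And>k. \<tau> k \<noteq> 0"
  shows "(\<Prod>a \<in> row B b. \<tau> (b - a - g) / \<tau> (b - a)) *
      (\<Prod>a \<in> row B b - {0, - b}. \<tau> (b - a + g) / \<tau> (b - a)) =
    (\<Prod>i \<in> steps. \<tau> (- i) / \<tau> i) *
      (\<Prod>y \<in> edge g B - {0, - b, b + g}. \<tau> (b + g - y) / \<tau> \<bar>b - y\<bar>)"
proof -
  define X where "X = row B b"
  define E where "E = {y \<in> edge g B. y < b}"
  define E1 where "E1 = {y \<in> edge g B - {0, - b, b + g}. y < b}"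
  define E2 where "E2 = {y \<in> edge g B - {0, - b, b + g}. \<not> y < b}"
  have fX: "finite X" by (simp add: X_def finite_row)
  have fT: "finite (edge g B)" using finite_edge[OF fin pos] .
  have fE: "finite E" "finite E1" "finite E2" using fT by (auto simp: E_def E1_def E2_def)
  have nzp: "(\<Prod>x\<in>A. \<tau> (f x)) \<noteq> 0" for f :: "int \<Rightarrow> int" and A
    using nz by (cases "finite A") auto
  have A: "(\<Prod>a\<in>X. \<tau> (b - a - g)) * (\<Prod>y\<in>E. \<tau> (b - y)) =
      (\<Prod>a\<in>X. \<tau> (b - a)) * (\<Prod>i\<in>steps. \<tau> (- i))"
  proof -
    have "(\<Prod>a\<in>X. \<tau> (b - a - g)) = (\<Prod>a\<in>(\<lambda>a. a + g) ` X. \<tau> (b - a))"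
      by (subst prod.reindex) (auto simp: inj_on_def algebra_simps)
    moreover have "(\<Prod>i\<in>steps. \<tau> (- i)) = (\<Prod>a\<in>(\<lambda>i. b + i) ` steps. \<tau> (b - a))"
      by (subst prod.reindex) (auto simp: inj_on_def algebra_simps)
    ultimately show ?thesis
      using prod_exchange[of X "(\<lambda>a. a + g) ` X" "\<lambda>a. \<tau> (b - a)"] fX
      by (simp add: X_def E_def row_minus_shift shift_minus_row)
  qed
  have C: "(\<Prod>a\<in>X. \<tau> (b - a + g)) * (\<Prod>i\<in>steps. \<tau> (g - i)) =
      (\<Prod>a\<in>X. \<tau> (b - a)) * (\<Prod>y\<in>E. \<tau> (b + g - y))"
  proof -
    have "(\<Prod>a\<in>X. \<tau> (b - a + g)) = (\<Prod>a\<in>(\<lambda>a. a - g) ` X. \<tau> (b - a))"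
      by (subst prod.reindex) (auto simp: inj_on_def algebra_simps)
    moreover have "(\<Prod>i\<in>steps. \<tau> (g - i)) = (\<Prod>a\<in>(\<lambda>i. b - g + i) ` steps. \<tau> (b - a))"
      by (subst prod.reindex) (auto simp: inj_on_def algebra_simps)
    moreover have "(\<Prod>y\<in>E. \<tau> (b + g - y)) = (\<Prod>a\<in>(\<lambda>y. y - g) ` E. \<tau> (b - a))"
      by (subst prod.reindex) (auto simp: inj_on_def algebra_simps)
    ultimately show ?thesis
      using prod_exchange[of X "(\<lambda>a. a - g) ` X" "\<lambda>a. \<tau> (b - a)"] fX
      by (simp add: X_def E_def row_minus_unshift unshift_minus_row)
  qed
  have X_split: "prod f X = f 0 * f (- b) * prod f (X - {0, - b})" for f :: "int \<Rightarrow> 'a"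
  proof -
    have "0 \<in> X" "- b \<in> X - {0}" using zero_notin minus_b_notin b_pos by (auto simp: X_def row_iff)
    moreover have "X - {0, - b} = X - {0} - {- b}" by auto
    ultimately show ?thesis
      using prod.remove[of X 0 f] prod.remove[of "X - {0}" "- b" f] fX by (simp add: mult.assoc)
  qed
  have E_split: "prod f E = f 0 * f (- b) * prod f E1" for f :: "int \<Rightarrow> 'a"
  proof -
    have "0 \<in> E" "- b \<in> E - {0}" using edge_special b_pos by (auto simp: E_def)
    moreover have "E1 = E - {0} - {- b}" using g_pos by (auto simp: E_def E1_def)
    ultimately show ?thesis
      using prod.remove[of E 0 f] prod.remove[of "E - {0}" "- b" f] fE by (simp add: mult.assoc)
  qed
  have E2: "(\<Prod>y\<in>E2. \<tau> (b + g - y) / \<tau> (y - b)) = (\<Prod>i\<in>{1..g - 1} - steps. \<tau> (g - i) / \<tau> i)"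
    unfolding E2_def edge_above by (subst prod.reindex) (auto simp: inj_on_def algebra_simps)
  \<comment> \<open>The substitution \<open>i \<mapsto> g - i\<close> makes the full product of
    \<open>\<tau> (g - i) / \<tau> i\<close> equal to 1. Hence the edges above \<open>b\<close>,
    which run over the complement of \<open>steps\<close>, supply the inverse of the product over
    \<open>steps\<close>.\<close>
  have "(\<Prod>i\<in>{1..g - 1}. \<tau> (g - i)) = (\<Prod>i\<in>{1..g - 1}. \<tau> i)"
    by (rule prod.reindex_bij_witness[of _ "\<lambda>i. g - i" "\<lambda>i. g - i"]) auto
  then have "(\<Prod>i\<in>{1..g - 1}. \<tau> (g - i) / \<tau> i) = 1"
    using nzp[of "\<lambda>i. i" "{1..g - 1}"] by (simp add: prod_dividef)
  moreover have "(\<Prod>i\<in>{1..g - 1}. \<tau> (g - i) / \<tau> i) =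
      (\<Prod>i\<in>{1..g - 1} - steps. \<tau> (g - i) / \<tau> i) * (\<Prod>i\<in>steps. \<tau> (g - i) / \<tau> i)"
    by (rule prod.subset_diff) (auto simp: steps_def)
  ultimately have R: "(\<Prod>y\<in>E2. \<tau> (b + g - y) / \<tau> (y - b)) * (\<Prod>i\<in>steps. \<tau> (g - i) / \<tau> i) = 1"
    unfolding E2 by simp
  have T_split: "(\<Prod>y \<in> edge g B - {0, - b, b + g}. \<tau> (b + g - y) / \<tau> \<bar>b - y\<bar>) =
     (\<Prod>y\<in>E1. \<tau> (b + g - y) / \<tau> (b - y)) * (\<Prod>y\<in>E2. \<tau> (b + g - y) / \<tau> (y - b))"
  proof -
    have "edge g B - {0, - b, b + g} = E1 \<union> E2" by (auto simp: E1_def E2_def)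
    moreover have "(\<Prod>y \<in> E1 \<union> E2. \<tau> (b + g - y) / \<tau> \<bar>b - y\<bar>) =
       (\<Prod>y \<in> E1. \<tau> (b + g - y) / \<tau> \<bar>b - y\<bar>) * (\<Prod>y \<in> E2. \<tau> (b + g - y) / \<tau> \<bar>b - y\<bar>)"
      using fE by (intro prod.union_disjoint) (auto simp: E1_def E2_def)
    moreover have "(\<Prod>y \<in> E1. \<tau> (b + g - y) / \<tau> \<bar>b - y\<bar>) = (\<Prod>y\<in>E1. \<tau> (b + g - y) / \<tau> (b - y))"
      by (rule prod.cong) (auto simp: E1_def)
    moreover have "(\<Prod>y \<in> E2. \<tau> (b + g - y) / \<tau> \<bar>b - y\<bar>) = (\<Prod>y\<in>E2. \<tau> (b + g - y) / \<tau> (y - b))"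
      by (rule prod.cong) (auto simp: E2_def)
    ultimately show ?thesis by simp
  qed
  \<comment> \<open>The factor of the gaps 0 and \<open>- b\<close>, absent both from the second
    product over the row and from the product over edges. Multiplying by \<open>q\<close> completes
    both products, and it cancels at the end.\<close>
  define q where "q = \<tau> (b + g) / \<tau> b * (\<tau> (b + b + g) / \<tau> (b + b))"
  have q: "q \<noteq> 0" using nz by (simp add: q_def)
  have L1: "(\<Prod>a\<in>X. \<tau> (b - a - g) / \<tau> (b - a)) = (\<Prod>i\<in>steps. \<tau> (- i)) / (\<Prod>y\<in>E. \<tau> (b - y))"
    using A nzp by (simp add: prod_dividef frac_eq_eq mult.commute)
  have L2: "q * (\<Prod>a\<in>X - {0, - b}. \<tau> (b - a + g) / \<tau> (b - a)) =
      (\<Prod>y\<in>E. \<tau> (b + g - y)) / (\<Prod>i\<in>steps. \<tau> (g - i))"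
  proof -
    have "q * (\<Prod>a\<in>X - {0, - b}. \<tau> (b - a + g) / \<tau> (b - a)) = (\<Prod>a\<in>X. \<tau> (b - a + g) / \<tau> (b - a))"
      by (subst X_split) (simp add: q_def)
    also have "\<dots> = (\<Prod>y\<in>E. \<tau> (b + g - y)) / (\<Prod>i\<in>steps. \<tau> (g - i))"
      using C nzp by (simp add: prod_dividef frac_eq_eq mult.commute)
    finally show ?thesis .
  qed
  have L3: "q * (\<Prod>y\<in>E1. \<tau> (b + g - y) / \<tau> (b - y)) = (\<Prod>y\<in>E. \<tau> (b + g - y)) / (\<Prod>y\<in>E. \<tau> (b - y))"
    unfolding prod_dividef[symmetric] by (subst E_split) (simp add: q_def algebra_simps)
  have "q * ((\<Prod>a\<in>X. \<tau> (b - a - g) / \<tau> (b - a)) *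
      (\<Prod>a\<in>X - {0, - b}. \<tau> (b - a + g) / \<tau> (b - a))) =
      (\<Prod>i\<in>steps. \<tau> (- i)) / (\<Prod>y\<in>E. \<tau> (b - y)) *
        ((\<Prod>y\<in>E. \<tau> (b + g - y)) / (\<Prod>i\<in>steps. \<tau> (g - i)))"
    unfolding L1 L2[symmetric] by (simp add: mult.left_commute)
  also have "\<dots> = (\<Prod>i\<in>steps. \<tau> (- i)) / (\<Prod>i\<in>steps. \<tau> (g - i)) *
      (q * (\<Prod>y\<in>E1. \<tau> (b + g - y) / \<tau> (b - y)))"
    unfolding L3 by (simp add: mult.commute)
  also have "\<dots> = (\<Prod>i\<in>steps. \<tau> (- i)) / (\<Prod>i\<in>steps. \<tau> (g - i)) *
      (q * (\<Prod>y\<in>E1. \<tau> (b + g - y) / \<tau> (b - y))) *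
      ((\<Prod>y\<in>E2. \<tau> (b + g - y) / \<tau> (y - b)) * (\<Prod>i\<in>steps. \<tau> (g - i) / \<tau> i))"
    unfolding R by simp
  also have "\<dots> = q * ((\<Prod>i\<in>steps. \<tau> (- i) / \<tau> i) *
      ((\<Prod>y\<in>E1. \<tau> (b + g - y) / \<tau> (b - y)) * (\<Prod>y\<in>E2. \<tau> (b + g - y) / \<tau> (y - b))))"
    using nzp[of "\<lambda>i. g - i" steps] by (simp add: prod_dividef[of _ _ steps] field_simps)
  finally show ?thesis using q unfolding T_split X_def by simp
qed

end

section \<open>Removing the largest bead\<close>

text \<open>With \<open>x\<close> and \<open>y\<close> equal to \<open>g / 2\<close> plus entries of
  \<open>r\<close>, the arguments are the differences and sums of those entries. The denominators of
  the theorem are the same product for the empty core.\<close>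

definition pair_prod :: "(int \<Rightarrow> 'a :: field) \<Rightarrow> int \<Rightarrow> int set \<Rightarrow> 'a" where
  "pair_prod \<tau> g V = (\<Prod>(x, y) \<in> {(x, y). x \<in> V \<and> y \<in> V \<and> y < x}. \<tau> (x - y) * \<tau> (x + y - g))"

text \<open>The new pairs join \<open>w\<close> to each \<open>x\<close>; \<open>?h\<close> puts the
  larger component first, whence the absolute value.\<close>

lemma pair_prod_insert:
  assumes "finite V" "w \<notin> V"
  shows "pair_prod \<tau> g (insert w V) = pair_prod \<tau> g V * (\<Prod>x\<in>V. \<tau> \<bar>w - x\<bar> * \<tau> (w + x - g))"
proof -
  let ?f = "\<lambda>(x, y). \<tau> (x - y) * \<tau> (x + y - g)"
  let ?P = "\<lambda>V. {(x, y). x \<in> V \<and> y \<in> V \<and> y < x}"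
  let ?h = "\<lambda>x. (max w x, min w x)"
  have inj: "inj_on ?h V" using assms(2) by (auto simp: inj_on_def max_def min_def split: if_splits)
  have eq: "?P (insert w V) = ?P V \<union> ?h ` V"
  proof (rule set_eqI, clarify)
    fix x y
    have "(x, y) \<in> ?h ` V \<longleftrightarrow> x = w \<and> y \<in> V \<and> y < w \<or> y = w \<and> x \<in> V \<and> w < x"
    proof
      assume "x = w \<and> y \<in> V \<and> y < w \<or> y = w \<and> x \<in> V \<and> w < x"
      then show "(x, y) \<in> ?h ` V"
        by (auto intro: image_eqI[of _ _ x] image_eqI[of _ _ y])
    qed (use assms(2) in \<open>auto simp: max_def min_def split: if_splits\<close>)
    then show "(x, y) \<in> ?P (insert w V) \<longleftrightarrow> (x, y) \<in> ?P V \<union> ?h ` V" by auto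
  qed
  have fin: "finite (?P V)" by (rule finite_subset[of _ "V \<times> V"]) (use assms in auto)
  have "prod ?f (?P (insert w V)) = prod ?f (?P V) * prod ?f (?h ` V)"
    unfolding eq using assms fin
    by (intro prod.union_disjoint) (auto simp: max_def min_def split: if_splits)
  also have "prod ?f (?h ` V) = (\<Prod>x\<in>V. \<tau> \<bar>w - x\<bar> * \<tau> (w + x - g))"
    using inj by (subst prod.reindex) (auto intro!: prod.cong simp: max_def min_def algebra_simps)
  finally show ?thesis by (simp add: pair_prod_def)
qed

text \<open>Here \<open>M\<close> is the diagram with \<open>b\<close> present and
  \<open>maya B\<close> the one after its removal; they differ only at \<open>b\<close> and
  \<open>- b\<close>.\<close>

locale remove_bead = top_bead g b "insert b B" for g b B +
  assumes new: "\<And>x. x \<in> B \<Longrightarrow> x < b"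
begin

lemma pos': "B \<subseteq> {0<..}" using pos by auto

lemma fin': "finite B" using fin by auto

lemma maya_insert: "k \<in> M \<longleftrightarrow> k = b \<or> k \<in> maya B \<and> k \<noteq> - b"
  using b_pos pos' by (auto simp: maya_def)

lemma b_notin': "b \<notin> maya B"
  using new b_pos by (auto simp: maya_def)

lemma minus_b_in': "- b \<in> maya B"
  using b_notin' uminus_in_maya_iff[OF pos', of b] b_pos by auto

text \<open>Removal turns \<open>b\<close> into a gap and \<open>- b\<close> into a bead. No bead
  \<open>b + g\<close> depended on \<open>b\<close>, and \<open>- b - g\<close> is a bead because
  everything below \<open>- b\<close> is.\<close>

lemma core': "core_beads g B"
  unfolding core_beads_def
proof
  fix k assume k: "k \<in> maya B"
  show "k - g \<in> maya B"
  proof (cases "k = - b")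
    case True
    then show ?thesis using new[of "g + b"] g_pos b_pos by (auto simp: maya_def)
  next
    case False
    have "k \<noteq> b + g" using k new[of "b + g"] g_pos b_pos by (auto simp: maya_def)
    then show ?thesis using core_beadsD[OF core, of k] k False by (auto simp: maya_insert)
  qed
qed

text \<open>The positions \<open>b\<close> and \<open>- b\<close> lie outside the range from
  \<open>- c\<close> to \<open>c\<close>, so the rows of smaller beads survive the removal.\<close>

lemma row_old: "c \<in> B \<Longrightarrow> row (insert b B) c = row B c"
  using new[of c] by (auto simp: row_def maya_insert)

definition "common = upper g (insert b B) - {b + g}"
text \<open>After the removal both \<open>b\<close> and \<open>g - b\<close> are edges, mirror
  images of each other; the larger one exceeds \<open>g / 2\<close> and takes the place of
  \<open>b + g\<close>.\<close>

definition "entry = max b (g - b)"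

lemma twice_b: "2 * b \<noteq> g" using g_odd by auto

lemma upper_new: "upper g (insert b B) = insert (b + g) common" "b + g \<notin> common"
  using edge_special b_pos g_pos by (auto simp: common_def upper_def)

lemma entry_upper: "entry \<in> upper g B"
proof -
  have "b - g \<in> maya B"
    using core_beadsD[OF core b_in] g_pos by (auto simp: maya_insert)
  moreover from this have "b - g \<noteq> 0" using zero_notin_maya[OF pos'] by auto
  ultimately have "g - b \<notin> maya B" using uminus_in_maya_iff[OF pos', of "b - g"] by auto
  then show ?thesis
    using \<open>b - g \<in> maya B\<close> b_notin' minus_b_in' twice_b
    by (auto simp: entry_def upper_def edge_def max_def)
qed

lemma common_iff: "x \<in> common \<longleftrightarrow> x \<in> upper g B \<and> x \<noteq> entry"
  using b_pos g_pos b_notin' unfolding common_def upper_def edge_def entry_def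
  by (auto simp: maya_insert max_def)

lemma upper_old: "upper g B = insert entry common" "entry \<notin> common"
  using entry_upper by (auto simp: common_iff)

lemma finite_common: "finite common"
  using finite_upper[OF fin' pos'] by (rule finite_subset[rotated]) (auto simp: common_iff)

lemma common_bounds: "x \<in> common \<Longrightarrow> x < b + g" "x \<in> common \<Longrightarrow> g < 2 * x"
  using edge_le[of x] by (auto simp: common_def upper_def)

text \<open>The point \<open>- b\<close> is the mirror image of \<open>b + g\<close>, so deleting
  both and 0 leaves \<open>common\<close> and its reflection.\<close>

lemma edge_common: "edge g (insert b B) - {0, - b, b + g} = common \<union> (\<lambda>x. g - x) ` common"
proof -
  have "0 \<notin> common" "g \<notin> common" "- b \<notin> common" "b + g \<notin> (\<lambda>x. g - x) ` common"
    using common_bounds(2)[of 0] common_bounds(2)[of "- b"] b_pos g_pos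
      zero_notin by (auto simp: common_def upper_def edge_def)
  moreover have "- b \<notin> (\<lambda>x. g - x) ` common"
    by (auto simp: common_def)
  ultimately show ?thesis
    using edge_eq_upper[OF pos core g_pos g_odd, unfolded upper_new(1)] upper_new(2) by auto
qed

text \<open>Only the pairs joining \<open>b + g\<close> or \<open>entry\<close> to some
  \<open>x\<close> in \<open>common\<close> change. Their quotient for one \<open>x\<close> is the
  product of the two edge factors at \<open>x\<close> and at its mirror image
  \<open>g - x\<close>.\<close>

lemma pair_prod_step:
  fixes \<tau> :: "int \<Rightarrow> 'a :: field"
  assumes nz: "\<And>k. \<tau> k \<noteq> 0"
  shows "pair_prod \<tau> g (upper g (insert b B)) = pair_prod \<tau> g (upper g B) *
    (\<Prod>y \<in> edge g (insert b B) - {0, - b, b + g}. \<tau> (b + g - y) / \<tau> \<bar>b - y\<bar>)"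
proof -
  have nzp: "(\<Prod>x\<in>common. \<tau> \<bar>b - x\<bar> * \<tau> \<bar>b + x - g\<bar>) \<noteq> 0"
    using nz finite_common by auto
  have "(\<Prod>y \<in> edge g (insert b B) - {0, - b, b + g}. \<tau> (b + g - y) / \<tau> \<bar>b - y\<bar>) =
      (\<Prod>x\<in>common. \<tau> (b + g - x) / \<tau> \<bar>b - x\<bar>) *
      (\<Prod>x\<in>(\<lambda>x. g - x) ` common. \<tau> (b + g - x) / \<tau> \<bar>b - x\<bar>)"
    unfolding edge_common
  proof (rule prod.union_disjoint)
    show "common \<inter> (\<lambda>x. g - x) ` common = {}"
    proof (rule equals0I)
      fix x assume "x \<in> common \<inter> (\<lambda>x. g - x) ` common"
      then obtain y where "x \<in> common" "y \<in> common" "x = g - y" by auto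
      then show False using common_bounds(2)[of x] common_bounds(2)[of y] by simp
    qed
  qed (use finite_common in auto)
  also have "(\<Prod>x\<in>(\<lambda>x. g - x) ` common. \<tau> (b + g - x) / \<tau> \<bar>b - x\<bar>) =
      (\<Prod>x\<in>common. \<tau> (b + x) / \<tau> \<bar>b + x - g\<bar>)"
    by (subst prod.reindex) (auto simp: inj_on_def algebra_simps)
  finally have 1: "(\<Prod>y \<in> edge g (insert b B) - {0, - b, b + g}. \<tau> (b + g - y) / \<tau> \<bar>b - y\<bar>) =
      (\<Prod>x\<in>common. \<tau> (b + g - x) * \<tau> (b + x)) / (\<Prod>x\<in>common. \<tau> \<bar>b - x\<bar> * \<tau> \<bar>b + x - g\<bar>)"
    by (simp add: prod_dividef prod.distrib)
  have 2: "pair_prod \<tau> g (upper g (insert b B)) =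
      pair_prod \<tau> g common * (\<Prod>x\<in>common. \<tau> (b + g - x) * \<tau> (b + x))"
    unfolding upper_new(1) pair_prod_insert[OF finite_common upper_new(2)]
    using common_bounds(1)
    by (intro arg_cong2[where f = "(*)"] prod.cong refl) (force simp: algebra_simps)+
  \<comment> \<open>Choosing \<open>g - b\<close> instead of \<open>b\<close> merely swaps the two
    factors.\<close>
  have "\<tau> \<bar>entry - x\<bar> * \<tau> (entry + x - g) = \<tau> \<bar>b - x\<bar> * \<tau> \<bar>b + x - g\<bar>" if "x \<in> common" for x
  proof (cases "g - b \<le> b")
    case True
    then have "entry = b" by (simp add: entry_def)
    then show ?thesis using common_bounds(2)[OF that] True by simp
  next
    case False
    then have "\<bar>entry - x\<bar> = \<bar>b + x - g\<bar>" "entry + x - g = \<bar>b - x\<bar>"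
      using common_bounds(2)[OF that] by (auto simp: entry_def max_def)
    then show ?thesis by (simp add: mult.commute)
  qed
  then have 3: "pair_prod \<tau> g (upper g B) =
      pair_prod \<tau> g common * (\<Prod>x\<in>common. \<tau> \<bar>b - x\<bar> * \<tau> \<bar>b + x - g\<bar>)"
    unfolding upper_old(1) pair_prod_insert[OF finite_common upper_old(2)] by simp
  show ?thesis unfolding 1 2 3 using nzp by simp
qed

text \<open>Both candidates for \<open>entry\<close> give the square of \<open>2 * b - g\<close>,
  and \<open>b + g\<close> gives that of \<open>2 * b + g\<close>; the difference is
  \<open>8 * g * b\<close>.\<close>

lemma square_sum_step:
  "(\<Sum>x\<in>upper g (insert b B). (2 * x - g)\<^sup>2) = (\<Sum>x\<in>upper g B. (2 * x - g)\<^sup>2) + 8 * g * b"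
proof -
  have "(2 * (b + g) - g)\<^sup>2 = (2 * entry - g)\<^sup>2 + 8 * g * b"
    by (simp add: entry_def max_def power2_eq_square algebra_simps)
  then show ?thesis
    unfolding upper_old(1) upper_new(1) using finite_common upper_old(2) upper_new(2) by simp
qed

end

lemma remove_beadI:
  assumes "insert b B \<subseteq> {0<..}" "finite B" "\<forall>x\<in>B. x < b" "core_beads g (insert b B)" "0 < g" "odd g"
  shows "remove_bead g b B"
  using assms by unfold_locales (auto simp: less_imp_le)

text \<open>Beads are added in increasing order, leaving earlier rows intact. The product over edges
  by which \<open>row_prod\<close> expresses the new row is the one by which
  \<open>pair_prod\<close> grows. The empty core enters as a factor on the left, avoiding
  division.\<close>

lemma beads_prod:
  fixes \<tau> :: "int \<Rightarrow> 'a :: field"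
  assumes "finite B" "B \<subseteq> {0<..}" "core_beads g B" "0 < g" "odd g" and nz: "\<And>k. \<tau> k \<noteq> 0"
  shows "(\<Prod>b\<in>B. (\<Prod>a \<in> row B b. \<tau> (b - a - g) / \<tau> (b - a)) *
        (\<Prod>a \<in> row B b - {0, - b}. \<tau> (b - a + g) / \<tau> (b - a))) * pair_prod \<tau> g (upper g {}) =
    (\<Prod>b\<in>B. \<Prod>i \<in> {i \<in> {1..g - 1}. b - g + i \<in> row B b}. \<tau> (- i) / \<tau> i) * pair_prod \<tau> g (upper g B)"
  using assms(1-3)
proof (induction B rule: finite_linorder_max_induct)
  case empty
  then show ?case by simp
next
  case (insert b B)
  interpret remove_bead g b B
    using insert.prems insert.hyps assms by (intro remove_beadI) auto
  have b: "b \<notin> B" using new by auto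
  let ?L = "\<lambda>B b. (\<Prod>a \<in> row B b. \<tau> (b - a - g) / \<tau> (b - a)) *
        (\<Prod>a \<in> row B b - {0, - b}. \<tau> (b - a + g) / \<tau> (b - a))"
  let ?R = "\<lambda>B b. \<Prod>i \<in> {i \<in> {1..g - 1}. b - g + i \<in> row B b}. \<tau> (- i) / \<tau> i"
  let ?T = "\<Prod>y \<in> edge g (insert b B) - {0, - b, b + g}. \<tau> (b + g - y) / \<tau> \<bar>b - y\<bar>"
  have "prod (?L (insert b B)) (insert b B) = ?L (insert b B) b * prod (?L B) B"
    using prod.insert[OF fin' b, of "?L (insert b B)"] by (simp add: row_old cong: prod.cong)
  also have "?L (insert b B) b = ?R (insert b B) b * ?T"
    using row_prod[of \<tau>] nz by (simp add: steps_def)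
  finally have 1: "prod (?L (insert b B)) (insert b B) = ?R (insert b B) b * ?T * prod (?L B) B" .
  have 2: "prod (?R (insert b B)) (insert b B) = ?R (insert b B) b * prod (?R B) B"
    using prod.insert[OF fin' b, of "?R (insert b B)"] by (simp add: row_old cong: prod.cong)
  have 3: "pair_prod \<tau> g (upper g (insert b B)) = pair_prod \<tau> g (upper g B) * ?T"
    using pair_prod_step[of \<tau>] nz by simp
  show ?case
    unfolding 1 2 3 using arg_cong[OF insert.IH[OF pos' core'], of "(*) (?R (insert b B) b * ?T)"]
    by (simp only: mult_ac)
qed

lemma beads_square_sum:
  assumes "finite B" "B \<subseteq> {0<..}" "core_beads g B" "0 < g" "odd g"
  shows "(\<Sum>x\<in>upper g B. (2 * x - g)\<^sup>2) = (\<Sum>x\<in>upper g {}. (2 * x - g)\<^sup>2) + 8 * g * \<Sum>B"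
  using assms(1-3)
proof (induction B rule: finite_linorder_max_induct)
  case empty
  then show ?case by simp
next
  case (insert b B)
  interpret remove_bead g b B
    using insert.prems insert.hyps assms by (intro remove_beadI) auto
  have b: "b \<notin> B" using new by auto
  show ?case
    using insert.IH[OF pos' core'] square_sum_step b fin' by (simp add: algebra_simps)
qed

section \<open>Boxes as pairs of beads\<close>

definition beads :: "nat list \<Rightarrow> int set" where
  "beads lam = {k. border_word lam k = 0}"

lemma mem_beads: "k \<in> beads lam \<longleftrightarrow> (\<exists>i\<ge>1. k = int (prt lam i) - int i)"
  by (simp add: beads_def border_word_def)

text \<open>As parts weakly decrease, the rows with at least \<open>j\<close> boxes are the first
  \<open>conj_prt lam j\<close> ones.\<close>

lemma le_prt_iff_le_conj_prt:
  assumes "is_partition lam" "1 \<le> i" "1 \<le> j"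
  shows "j \<le> prt lam i \<longleftrightarrow> i \<le> conj_prt lam j"
proof
  assume j: "j \<le> prt lam i"
  then have "i \<le> length lam" using assms by (auto simp: prt_def split: if_splits)
  then have "{1..i} \<subseteq> {i \<in> {1..length lam}. j \<le> prt lam i}"
    using j prt_antimono[OF assms(1), of _ i] by (auto intro: order_trans)
  from card_mono[OF _ this] show "i \<le> conj_prt lam j" by (simp add: conj_prt_def)
next
  assume i: "i \<le> conj_prt lam j"
  show "j \<le> prt lam i"
  proof (rule ccontr)
    assume j: "\<not> j \<le> prt lam i"
    have "{i \<in> {1..length lam}. j \<le> prt lam i} \<subseteq> {1..<i}"
    proof
      fix k assume k: "k \<in> {i \<in> {1..length lam}. j \<le> prt lam i}"
      then have "k < i" using prt_antimono[OF assms(1,2), of k] j by (cases "k < i") auto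
      then show "k \<in> {1..<i}" using k by auto
    qed
    from card_mono[OF _ this] have "conj_prt lam j \<le> i - 1" by (simp add: conj_prt_def)
    then show False using i assms by simp
  qed
qed

lemma conj_prt_antimono: "i \<le> j \<Longrightarrow> conj_prt lam j \<le> conj_prt lam i"
  unfolding conj_prt_def by (intro card_mono) auto

lemma mem_boxes: "(i, j) \<in> boxes lam \<longleftrightarrow> 1 \<le> i \<and> 1 \<le> j \<and> j \<le> prt lam i"
  by (auto simp: boxes_def prt_def)

definition row_bead :: "nat list \<Rightarrow> nat \<Rightarrow> int" where
  "row_bead lam i = int (prt lam i) - int i"

text \<open>The index in the word of the horizontal step at the foot of column \<open>j\<close>,
  just as \<open>row_bead\<close> is that of the vertical step ending row \<open>i\<close>.\<close>

definition col_gap :: "nat list \<Rightarrow> nat \<Rightarrow> int" where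
  "col_gap lam j = int j - 1 - int (conj_prt lam j)"

lemma row_bead_less:
  assumes "is_partition lam" "1 \<le> i" "i < j"
  shows "row_bead lam j < row_bead lam i"
  using prt_antimono[OF assms(1,2), of j] assms by (auto simp: row_bead_def)

lemma row_bead_less_iff:
  assumes "is_partition lam" "1 \<le> i" "1 \<le> j"
  shows "row_bead lam j < row_bead lam i \<longleftrightarrow> i < j"
  using row_bead_less[OF assms(1), of i j] row_bead_less[OF assms(1), of j i] assms
  by (cases i j rule: linorder_cases) auto

lemma col_gap_less: "i < j \<Longrightarrow> col_gap lam i < col_gap lam j"
  using conj_prt_antimono[of i j lam] by (auto simp: col_gap_def)

text \<open>Bead minus gap is \<open>(prt lam i - j) + (conj_prt lam j - i) + 1\<close> over the
  integers; both brackets are nonnegative inside the diagram and both are negative outside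
  it.\<close>

lemma box_iff_gap_less:
  assumes "is_partition lam" "1 \<le> i" "1 \<le> j"
  shows "j \<le> prt lam i \<Longrightarrow> col_gap lam j < row_bead lam i"
    and "\<not> j \<le> prt lam i \<Longrightarrow> row_bead lam i < col_gap lam j"
  using le_prt_iff_le_conj_prt[OF assms] by (auto simp: col_gap_def row_bead_def)

lemma mem_beads': "k \<in> beads lam \<longleftrightarrow> (\<exists>i\<ge>1. k = row_bead lam i)"
  by (simp add: mem_beads row_bead_def)

lemma notin_beads_iff:
  assumes "is_partition lam"
  shows "a \<notin> beads lam \<longleftrightarrow> (\<exists>j\<ge>1. a = col_gap lam j)"
proof
  assume a: "a \<notin> beads lam"
  \<comment> \<open>The first row whose bead lies below \<open>a\<close>. The column sought must
    have exactly \<open>i - 1\<close> boxes, which forces \<open>j = a + i\<close>.\<close>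
  define i where "i = (LEAST i. 1 \<le> i \<and> row_bead lam i < a)"
  \<comment> \<open>Beyond the last part the bead of row \<open>n\<close> is \<open>- n\<close>, so
    a large \<open>n\<close> shows that such a row exists.\<close>
  define n where "n = Suc (length lam + nat (- a))"
  have "prt lam n = 0" "- int n < a" by (simp_all add: n_def prt_def)
  then have "1 \<le> n \<and> row_bead lam n < a" by (simp add: row_bead_def n_def)
  then have i: "1 \<le> i \<and> row_bead lam i < a"
    unfolding i_def by (rule LeastI)
  have less: "a < row_bead lam k" if "1 \<le> k" "k < i" for k
  proof -
    have "\<not> row_bead lam k < a"
      using not_less_Least[of k "\<lambda>i. 1 \<le> i \<and> row_bead lam i < a"] that unfolding i_def by blast
    moreover have "a \<noteq> row_bead lam k" using that a by (auto simp: mem_beads')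
    ultimately show ?thesis by simp
  qed
  define j where "j = nat (a + int i)"
  have "0 < a + int i" using i by (simp add: row_bead_def)
  then have j: "int j = a + int i" "1 \<le> j" by (simp_all add: j_def)
  have "prt lam i < j" using i j by (simp add: row_bead_def)
  then have "\<not> i \<le> conj_prt lam j"
    using i j le_prt_iff_le_conj_prt[OF assms, of i j] by simp
  moreover have "i - 1 \<le> conj_prt lam j"
  proof (cases "i = 1")
    case False
    then have "a < row_bead lam (i - 1)" using i by (intro less) auto
    then have "j \<le> prt lam (i - 1)" using i j by (simp add: row_bead_def of_nat_diff)
    moreover have "1 \<le> i - 1" using False i by linarith
    ultimately show ?thesis
      using j le_prt_iff_le_conj_prt[OF assms, of "i - 1" j] by simp
  qed simp
  ultimately have "conj_prt lam j = i - 1" by simp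
  then have "a = col_gap lam j" using i j by (simp add: col_gap_def of_nat_diff)
  then show "\<exists>j\<ge>1. a = col_gap lam j" using j by blast
next
  assume "\<exists>j\<ge>1. a = col_gap lam j"
  then show "a \<notin> beads lam"
  proof (elim exE conjE, intro notI)
    fix j assume j: "1 \<le> j" "a = col_gap lam j" and "a \<in> beads lam"
    then obtain i where i: "1 \<le> i" "a = row_bead lam i" by (auto simp: mem_beads')
    show False using box_iff_gap_less[OF assms i(1) j(1)] i j by (cases "j \<le> prt lam i") auto
  qed
qed

lemma col_gap_notin_beads: "is_partition lam \<Longrightarrow> 1 \<le> j \<Longrightarrow> col_gap lam j \<notin> beads lam"
  using notin_beads_iff by blast

lemma boxes_bij_betw:
  assumes "is_partition lam"
  shows "bij_betw (\<lambda>(i, j). (col_gap lam j, row_bead lam i)) (boxes lam)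
    {(a, b). a < b \<and> a \<notin> beads lam \<and> b \<in> beads lam}"
proof (rule bij_betw_imageI)
  show "inj_on (\<lambda>(i, j). (col_gap lam j, row_bead lam i)) (boxes lam)"
  proof (rule inj_onI, clarify)
    fix i j i' j'
    assume "(i, j) \<in> boxes lam" "(i', j') \<in> boxes lam"
      "col_gap lam j = col_gap lam j'" "row_bead lam i = row_bead lam i'"
    then show "i = i' \<and> j = j'"
      using row_bead_less[OF assms, of i i'] row_bead_less[OF assms, of i' i]
        col_gap_less[of j j' lam] col_gap_less[of j' j lam]
      by (cases i i' rule: linorder_cases; cases j j' rule: linorder_cases)
        (auto simp: mem_boxes)
  qed
  show "(\<lambda>(i, j). (col_gap lam j, row_bead lam i)) ` boxes lam =
      {(a, b). a < b \<and> a \<notin> beads lam \<and> b \<in> beads lam}" (is "?f ` _ = ?R")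
  proof (intro equalityI subsetI)
    fix p assume "p \<in> ?f ` boxes lam"
    then obtain i j where "p = (col_gap lam j, row_bead lam i)" "(i, j) \<in> boxes lam" by auto
    then show "p \<in> ?R"
      using box_iff_gap_less(1)[OF assms, of i j] notin_beads_iff[OF assms, of "col_gap lam j"]
      by (auto simp: mem_boxes mem_beads')
  next
    fix p assume p: "p \<in> ?R"
    obtain a b where ab: "p = (a, b)" by (cases p)
    with p obtain i j where "i \<ge> 1" "b = row_bead lam i" "j \<ge> 1" "a = col_gap lam j"
      using notin_beads_iff[OF assms, of a] mem_beads' by auto
    moreover from this have "j \<le> prt lam i"
      using p ab box_iff_gap_less(2)[OF assms, of i j] by fastforce
    ultimately show "p \<in> ?f ` boxes lam"
      using ab by (intro image_eqI[of _ _ "(i, j)"]) (auto simp: mem_boxes)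
  qed
qed

lemma hook_eq: "hook lam (i, j) = row_bead lam i - col_gap lam j"
  by (simp add: hook_def row_bead_def col_gap_def)

section \<open>Doubled distinct partitions\<close>

definition pos_beads :: "nat list \<Rightarrow> int set" where
  "pos_beads lam = {k \<in> beads lam. 0 < k}"

lemma pos_beads_pos: "pos_beads lam \<subseteq> {0<..}"
  by (auto simp: pos_beads_def)

lemma finite_pos_beads: "finite (pos_beads lam)"
proof (rule finite_subset)
  show "pos_beads lam \<subseteq> row_bead lam ` {..length lam}"
    by (auto simp: pos_beads_def mem_beads' row_bead_def prt_def split: if_splits)
qed auto

context
  fixes lam assumes dd: "lam \<in> doubled_distinct"
begin

lemma dd_partition: "is_partition lam"
  using dd by (simp add: doubled_distinct_def)

text \<open>Such an \<open>i\<close> is at most the Durfee size, where the defining condition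
  \<open>prt lam i = conj_prt lam i + 1\<close> applies.\<close>

lemma dd_col_gap:
  assumes "1 \<le> i" "i \<le> prt lam i"
  shows "col_gap lam i = - row_bead lam i"
proof -
  have "finite {s. s \<le> prt lam s}"
    by (rule finite_subset[of _ "{..length lam}"]) (auto simp: prt_def split: if_splits)
  then have "i \<le> durfee lam" using assms by (auto simp: durfee_def)
  then show ?thesis
    using dd assms by (auto simp: doubled_distinct_def col_gap_def row_bead_def)
qed

lemma dd_col_gap_nonneg:
  assumes "1 \<le> j" "\<not> j \<le> prt lam j"
  shows "0 \<le> col_gap lam j"
  using assms le_prt_iff_le_conj_prt[OF dd_partition, of j j] by (auto simp: col_gap_def)

text \<open>Positive beads and negative gaps both come from indices
  \<open>i \<le> prt lam i\<close>, and for these \<open>dd_col_gap\<close> matches the bead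
  \<open>k\<close> of row \<open>i\<close> with the gap \<open>- k\<close> of column
  \<open>i\<close>. A bead at 0 would also be a gap.\<close>

lemma beads_eq_maya: "beads lam = maya (pos_beads lam)"
proof -
  have 0: "0 \<notin> beads lam"
  proof
    assume "0 \<in> beads lam"
    then obtain i where i: "i \<ge> 1" "row_bead lam i = 0" by (auto simp: mem_beads')
    then have "i \<le> prt lam i" by (simp add: row_bead_def)
    then have "col_gap lam i = 0" using dd_col_gap[of i] i by simp
    then show False using col_gap_notin_beads[OF dd_partition i(1)] \<open>0 \<in> beads lam\<close> by simp
  qed
  have "- k \<notin> beads lam" if "k \<in> beads lam" "0 < k" for k
  proof -
    from that obtain i where i: "i \<ge> 1" "k = row_bead lam i" by (auto simp: mem_beads')
    then have "i \<le> prt lam i" using that by (simp add: row_bead_def)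
    then have "- k = col_gap lam i" using dd_col_gap[of i] i by simp
    then show ?thesis using col_gap_notin_beads[OF dd_partition i(1)] by simp
  qed
  moreover have "k \<in> beads lam" if k: "- k \<notin> beads lam" "0 < k" for k
  proof -
    from k notin_beads_iff[OF dd_partition, of "- k"]
    obtain j where j: "j \<ge> 1" "- k = col_gap lam j" by auto
    then have "j \<le> prt lam j" using dd_col_gap_nonneg[of j] k by auto
    then have "k = row_bead lam j" using dd_col_gap[of j] j by simp
    then show ?thesis using j by (auto simp: mem_beads')
  qed
  ultimately have sym: "- k \<in> beads lam \<longleftrightarrow> k \<notin> beads lam" if "0 < k" for k
    using that by blast
  show ?thesis
  proof (rule set_eqI)
    fix k
    show "k \<in> beads lam \<longleftrightarrow> k \<in> maya (pos_beads lam)"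
      using 0 sym[of "- k"]
      by (cases k "0::int" rule: linorder_cases) (simp_all add: maya_def pos_beads_def)
  qed
qed

text \<open>If \<open>j \<le> prt lam j\<close>, the sum of gap and bead is
  \<open>row_bead lam i - row_bead lam j\<close>, whose sign compares \<open>j\<close> with
  \<open>i\<close>. Otherwise gap and bead are nonnegative and the box is not below the
  diagonal.\<close>

lemma eps_eq:
  assumes "(i, j) \<in> boxes lam"
  shows "eps (i, j) = (if 0 \<le> col_gap lam j + row_bead lam i then 1 else - 1)"
proof -
  have ij: "1 \<le> i" "1 \<le> j" "j \<le> prt lam i" using assms by (auto simp: mem_boxes)
  have less: "col_gap lam j < row_bead lam i"
    using box_iff_gap_less(1)[OF dd_partition] ij by auto
  have "j < i \<longleftrightarrow> col_gap lam j + row_bead lam i < 0"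
  proof (cases "j \<le> prt lam j")
    case True
    then show ?thesis
      using dd_col_gap[of j] ij row_bead_less_iff[OF dd_partition, of j i] by auto
  next
    case False
    then have "0 \<le> col_gap lam j" using dd_col_gap_nonneg ij by auto
    moreover have "\<not> j < i" using False prt_antimono[OF dd_partition, of j i] ij by auto
    ultimately show ?thesis using less by auto
  qed
  then show ?thesis by (auto simp: eps_def)
qed

end

text \<open>Boxes with \<open>eps = 1\<close> correspond to pairs with \<open>a + b \<ge> 0\<close>; the map
  \<open>(a, b) \<mapsto> (- b, - a)\<close> sends the other pairs to those with \<open>a + b > 0\<close> and \<open>a \<noteq> 0\<close>.\<close>

lemma (in comm_monoid_set) boxes_doubled_distinct:
  assumes dd: "lam \<in> doubled_distinct" and B: "B = pos_beads lam"
  shows "F (\<lambda>s. u (hook lam s) (eps s)) (boxes lam) =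
    F (\<lambda>b. F (\<lambda>a. u (b - a) 1) (row B b) \<^bold>* F (\<lambda>a. u (b - a) (- 1)) (row B b - {0, - b})) B"
proof -
  let ?f = "\<lambda>(a, b). u (b - a) (if 0 \<le> a + b then 1 else - 1)"
  define P where "P = {(a, b). a < b \<and> a \<notin> maya B \<and> b \<in> maya B}"
  define S1 where "S1 = Sigma B (row B)"
  \<comment> \<open>Under \<open>h2\<close> the gap 0 would yield position 0, which is no bead, and
    \<open>- b\<close> would yield a pair with sum 0, already counted in \<open>S1\<close>.\<close>
  define S2 where "S2 = Sigma B (\<lambda>b. row B b - {0, - b})"
  define h1 where "h1 = (\<lambda>(b, a :: int). (a, b :: int))"
  define h2 where "h2 = (\<lambda>(b :: int, a :: int). (- b, - a))"
  have pos: "B \<subseteq> {0<..}" and fin: "finite B"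
    using B pos_beads_pos finite_pos_beads by auto
  have fS: "finite S1" "finite S2"
    using fin finite_row by (auto simp: S1_def S2_def)
  have inj: "inj_on h1 S1" "inj_on h2 S2" by (auto simp: h1_def h2_def inj_on_def)
  have um: "- k \<in> maya B \<longleftrightarrow> k \<notin> maya B" if "k \<noteq> 0" for k
    using uminus_in_maya_iff[OF pos that] .
  have z: "0 \<notin> maya B" using zero_notin_maya[OF pos] .
  have I1: "h1 ` S1 = {(a, b) \<in> P. 0 \<le> a + b}"
  proof (rule set_eqI, clarify)
    fix a b
    have "(a, b) \<in> h1 ` S1 \<longleftrightarrow> b \<in> B \<and> a \<in> row B b"
      by (auto simp: h1_def S1_def)
    also have "\<dots> \<longleftrightarrow> (a, b) \<in> P \<and> 0 \<le> a + b"
      using pos maya_pos[of b B] by (auto simp: row_def P_def maya_def)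
    finally show "(a, b) \<in> h1 ` S1 \<longleftrightarrow> (a, b) \<in> {(a, b) \<in> P. 0 \<le> a + b}" by simp
  qed
  have I2: "h2 ` S2 = {(a, b) \<in> P. \<not> 0 \<le> a + b}"
  proof (rule set_eqI, clarify)
    fix a b
    have "(a, b) \<in> h2 ` S2 \<longleftrightarrow> (- a, - b) \<in> S2"
      by (force simp: h2_def)
    also have "\<dots> \<longleftrightarrow> - a \<in> B \<and> a \<le> - b \<and> - b < - a \<and> - b \<notin> maya B \<and> b \<noteq> 0 \<and> b \<noteq> - a"
      by (auto simp: row_def S2_def)
    also have "\<dots> \<longleftrightarrow> (a, b) \<in> P \<and> \<not> 0 \<le> a + b"
    proof -
      have "- a \<in> B \<longleftrightarrow> a \<notin> maya B" if "a < 0" using um[of a] maya_pos[of "- a" B] that by auto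
      moreover have "- a \<in> B \<longrightarrow> a < 0" using pos by auto
      ultimately show ?thesis using um[of b] z by (auto simp: P_def)
    qed
    finally show "(a, b) \<in> h2 ` S2 \<longleftrightarrow> (a, b) \<in> {(a, b) \<in> P. \<not> 0 \<le> a + b}" by simp
  qed
  have "F (\<lambda>s. u (hook lam s) (eps s)) (boxes lam) = F ?f P"
  proof -
    have "F ?f P = F (\<lambda>s. ?f ((\<lambda>(i, j). (col_gap lam j, row_bead lam i)) s)) (boxes lam)"
      unfolding P_def B beads_eq_maya[OF dd, symmetric]
      by (rule reindex_bij_betw[symmetric, OF boxes_bij_betw[OF dd_partition[OF dd]]])
    also have "\<dots> = F (\<lambda>s. u (hook lam s) (eps s)) (boxes lam)"
      by (rule cong) (auto simp: hook_eq eps_eq[OF dd])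
    finally show ?thesis by (rule sym)
  qed
  also have "P = h1 ` S1 \<union> h2 ` S2" unfolding I1 I2 by auto
  also have "F ?f \<dots> = F ?f (h1 ` S1) \<^bold>* F ?f (h2 ` S2)"
    using fS by (intro union_disjoint finite_imageI) (auto simp: I1 I2)
  also have "F ?f (h1 ` S1) = F (\<lambda>(b, a). u (b - a) 1) S1"
    unfolding reindex[OF inj(1)] by (rule cong) (auto simp: h1_def S1_def row_def)
  also have "\<dots> = F (\<lambda>b. F (\<lambda>a. u (b - a) 1) (row B b)) B"
    using fin finite_row by (simp add: S1_def Sigma)
  also have "F ?f (h2 ` S2) = F (\<lambda>(b, a). u (b - a) (- 1)) S2"
    unfolding reindex[OF inj(2)] by (rule cong) (auto simp: h2_def S2_def row_def split: if_splits)
  also have "\<dots> = F (\<lambda>b. F (\<lambda>a. u (b - a) (- 1)) (row B b - {0, - b})) B"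
    using fin finite_row by (simp add: S2_def Sigma)
  finally show ?thesis by (simp add: distrib)
qed

section \<open>Size and hook counts in terms of beads\<close>

lemma finite_boxes: "finite (boxes lam)"
proof -
  have "boxes lam = Sigma {1..length lam} (\<lambda>i. {1..prt lam i})" by (auto simp: boxes_def)
  then show ?thesis by simp
qed

lemma card_boxes: "card (boxes lam) = sum_list lam"
proof -
  have "boxes lam = Sigma {1..length lam} (\<lambda>i. {1..prt lam i})" by (auto simp: boxes_def)
  then have "card (boxes lam) = (\<Sum>i\<in>{1..length lam}. prt lam i)" by simp
  also have "\<dots> = (\<Sum>i\<in>{0..<length lam}. lam ! i)"
    by (rule sum.reindex_bij_witness[of _ Suc "\<lambda>i. i - 1"]) (auto simp: prt_def)
  finally show ?thesis by (simp add: sum_list_sum_nth)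
qed

text \<open>Exactly one of \<open>k\<close> and \<open>- k\<close> is a gap for
  \<open>0 < k < b\<close>, so apart from 0 and \<open>- b\<close> the absolute values of the row
  run once through the numbers from 1 to \<open>b - 1\<close>.\<close>

lemma card_row:
  assumes "B \<subseteq> {0<..}" "b \<in> B"
  shows "card (row B b) = Suc (nat b)" "card (row B b - {0, - b}) = nat b - 1"
proof -
  have um: "- k \<in> maya B \<longleftrightarrow> k \<notin> maya B" if "k \<noteq> 0" for k
    using uminus_in_maya_iff[OF assms(1) that] .
  have b: "0 < b" using assms by auto
  have "b \<in> maya B" using assms by (auto simp: maya_def)
  then have s: "0 \<in> row B b" "- b \<in> row B b"
    using zero_notin_maya[OF assms(1)] um[of b] b by (auto simp: row_def)
  have "bij_betw abs (row B b - {0, - b}) {1..<b}"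
  proof (rule bij_betw_imageI)
    show "inj_on abs (row B b - {0, - b})"
    proof (rule inj_onI)
      fix x y assume "x \<in> row B b - {0, - b}" "y \<in> row B b - {0, - b}" "\<bar>x\<bar> = \<bar>y\<bar>"
      then show "x = y" using um[of y] by (auto simp: row_def abs_eq_iff)
    qed
    show "abs ` (row B b - {0, - b}) = {1..<b}"
    proof (intro equalityI subsetI)
      fix k assume k: "k \<in> {1..<b}"
      then have "k \<in> row B b - {0, - b} \<or> - k \<in> row B b - {0, - b}"
        using um[of k] by (auto simp: row_def)
      then show "k \<in> abs ` (row B b - {0, - b})"
      proof
        assume "k \<in> row B b - {0, - b}"
        then show ?thesis using k by (intro image_eqI[of _ _ k]) auto
      next
        assume "- k \<in> row B b - {0, - b}"
        then show ?thesis using k by (intro image_eqI[of _ _ "- k"]) auto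
      qed
    qed (auto simp: row_def)
  qed
  then show 2: "card (row B b - {0, - b}) = nat b - 1"
    using bij_betw_same_card by fastforce
  have "card (row B b - {0, - b}) = card (row B b) - 2"
    using s b by (subst card_Diff_subset) auto
  moreover have "card {0, - b} \<le> card (row B b)"
    using s by (intro card_mono finite_row) auto
  ultimately show "card (row B b) = Suc (nat b)" using 2 b by auto
qed

text \<open>Each bead \<open>b\<close> accounts for \<open>b + 1\<close> boxes with
  \<open>eps\<close> equal to 1 and \<open>b - 1\<close> others.\<close>

lemma size_doubled_distinct:
  assumes "lam \<in> doubled_distinct"
  shows "int (sum_list lam) = 2 * \<Sum>(pos_beads lam)"
proof -
  let ?B = "pos_beads lam"
  have "card (boxes lam) = (\<Sum>b\<in>?B. card (row ?B b) + card (row ?B b - {0, - b}))"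
    using sum.boxes_doubled_distinct[OF assms refl, of "\<lambda>_ _. 1 :: nat"] by simp
  also have "\<dots> = (\<Sum>b\<in>?B. 2 * nat b)"
    using pos_beads_pos by (intro sum.cong) (fastforce simp: card_row[OF pos_beads_pos])+
  also have "int \<dots> = (\<Sum>b\<in>?B. 2 * b)"
    unfolding of_nat_sum using pos_beads_pos by (intro sum.cong) fastforce+
  finally show ?thesis by (simp add: card_boxes sum_distrib_left)
qed

text \<open>A hook of length \<open>g - i\<close> on the bead \<open>b\<close> fixes the gap as
  \<open>b - g + i\<close>, so each bead contributes at most one box.\<close>

lemma alpha_doubled_distinct:
  assumes "lam \<in> doubled_distinct" "1 \<le> i" "i < g"
  shows "alpha g lam i =
    (\<Sum>b\<in>pos_beads lam. if b - int g + int i \<in> row (pos_beads lam) b then 1 else 0)"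
proof -
  let ?B = "pos_beads lam"
  let ?f = "\<lambda>h e. if h = int g - int i \<and> e = (1 :: int) then 1 else (0 :: nat)"
  have "alpha g lam i = (\<Sum>s\<in>boxes lam. ?f (hook lam s) (eps s))"
    unfolding alpha_def card_eq_sum by (rule sum.inter_filter[OF finite_boxes])
  also have "\<dots> = (\<Sum>b\<in>?B. (\<Sum>a\<in>row ?B b. if b - a = int g - int i then 1 else 0))"
    using sum.boxes_doubled_distinct[OF assms(1) refl, of ?f] by simp
  also have "\<dots> = (\<Sum>b\<in>?B. \<Sum>a\<in>row ?B b. if b - int g + int i = a then 1 else 0)"
    by (intro sum.cong if_cong) auto
  finally show ?thesis by (simp add: sum.delta finite_row)
qed

section \<open>The coding\<close>

context
  fixes g :: nat and lam :: "nat list"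
  assumes core: "is_core g lam" and g_pos: "0 < g"
begin

lemma core_partition: "is_partition lam"
  using core by (simp add: is_core_def)

text \<open>A bead \<open>k\<close> above a gap \<open>k - g\<close> would be a box of hook length
  \<open>g\<close>.\<close>

lemma beads_minus: "k \<in> beads lam \<Longrightarrow> k - int g \<in> beads lam"
proof (rule ccontr)
  assume k: "k \<in> beads lam" "k - int g \<notin> beads lam"
  then have "(k - int g, k) \<in> {(a, b). a < b \<and> a \<notin> beads lam \<and> b \<in> beads lam}"
    using g_pos by simp
  then obtain i j where ij: "(i, j) \<in> boxes lam" "k - int g = col_gap lam j" "k = row_bead lam i"
    unfolding bij_betw_imp_surj_on[OF boxes_bij_betw[OF core_partition], symmetric] by auto
  then have "hook lam (i, j) = int g" by (simp add: hook_eq)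
  then show False using core ij(1) by (auto simp: is_core_def)
qed

lemma beads_minus_mult: "k \<in> beads lam \<Longrightarrow> k - int n * int g \<in> beads lam"
proof (induction n)
  case (Suc n)
  then have "k - int n * int g - int g \<in> beads lam" by (intro beads_minus) auto
  then show ?case by (simp add: algebra_simps)
qed simp

text \<open>Within a residue class the beads of a core are closed downwards, so there is a single
  change from bead to gap. A candidate \<open>y\<close> above \<open>x\<close> would make
  \<open>x\<close> a bead by repeated subtraction of \<open>g\<close>.\<close>

lemma beta_eq:
  assumes "x - int g \<in> beads lam" "x \<notin> beads lam" "x mod int g = int i"
  shows "beta g lam i = x"
  unfolding beta_def
proof (rule Greatest_equality)
  have "x = (x div int g - 1 + 1) * int g + int i"
    using assms(3) div_mult_mod_eq[of x "int g"] by simp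
  moreover from this have "(x div int g - 1) * int g + int i = x - int g" by (simp add: algebra_simps)
  ultimately show "\<exists>k. x = (k + 1) * int g + int i \<and> border_word lam (k * int g + int i) = 0"
    using assms(1) by (metis (mono_tags, lifting) beads_def mem_Collect_eq)
next
  fix y assume "\<exists>k. y = (k + 1) * int g + int i \<and> border_word lam (k * int g + int i) = 0"
  then obtain k where k: "y = (k + 1) * int g + int i" "k * int g + int i \<in> beads lam"
    by (auto simp: beads_def)
  define m where "m = x div int g"
  have x: "x = m * int g + int i"
    using assms(3) div_mult_mod_eq[of x "int g"] by (simp add: m_def)
  show "y \<le> x"
  proof (rule ccontr)
    assume "\<not> y \<le> x"
    then have "m * int g < (k + 1) * int g" using k x by simp
    then have "m < k + 1" using g_pos by (simp add: mult_less_cancel_right)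
    then have "k * int g + int i - int (nat (k - m)) * int g = x"
      using x by (simp add: algebra_simps)
    then show False using beads_minus_mult[OF k(2), of "nat (k - m)"] assms(2) by simp
  qed
qed

lemma edge_exists:
  obtains x where "x - int g \<in> beads lam" "x \<notin> beads lam" "x mod int g = int i mod int g"
proof -
  \<comment> \<open>A walk through the residue class of \<open>i\<close>. It starts below
    \<open>- length lam\<close>, where all positions are beads, and passes \<open>prt lam 1\<close>,
    beyond which there are none, so it must cross from a bead to a gap.\<close>
  define z where "z = (\<lambda>n::nat. int i + (int n - int (length lam + i + 1)) * int g)"
  have "z 0 \<in> beads lam"
  proof -
    have "int (length lam + i + 1) \<le> int (length lam + i + 1) * int g"
      using g_pos by simp
    moreover have "z 0 = int i - int (length lam + i + 1) * int g"
      unfolding z_def by (simp add: algebra_simps)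
    ultimately have "z 0 \<le> - int (length lam) - 1" by linarith
    then have "1 \<le> nat (- z 0)" "z 0 = row_bead lam (nat (- z 0))"
      by (auto simp: row_bead_def prt_def)
    then show ?thesis unfolding mem_beads' by blast
  qed
  moreover have "\<exists>n. z n \<notin> beads lam"
  proof -
    have le: "k \<le> int (prt lam 1)" if "k \<in> beads lam" for k
      using that prt_antimono[OF core_partition, of 1] by (fastforce simp: mem_beads)
    define n where "n = length lam + i + 1 + prt lam 1 + 1"
    have "int (prt lam 1 + 1) \<le> int (prt lam 1 + 1) * int g" using g_pos by simp
    moreover have "z n = int i + int (prt lam 1 + 1) * int g" by (simp add: z_def n_def)
    ultimately have "int (prt lam 1) < z n" by linarith
    then show ?thesis using le[of "z n"] by (intro exI[of _ n]) auto
  qed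
  ultimately obtain n where n: "z n \<in> beads lam" "z (Suc n) \<notin> beads lam"
    using nat_induct[of "\<lambda>n. z n \<in> beads lam"] by blast
  show ?thesis
  proof (rule that)
    have "z (Suc n) - int g = z n" by (simp add: z_def algebra_simps)
    then show "z (Suc n) - int g \<in> beads lam" using n by simp
    show "z (Suc n) mod int g = int i mod int g" by (simp add: z_def)
  qed (use n in simp)
qed

lemma beta_image: "beta g lam ` {0..<g} = {x. x - int g \<in> beads lam \<and> x \<notin> beads lam}" (is "_ = ?E")
  and beta_inj: "inj_on (beta g lam) {0..<g}"
proof -
  have *: "beta g lam i \<in> ?E \<and> beta g lam i mod int g = int i" if "i < g" for i
  proof -
    obtain x where "x - int g \<in> beads lam" "x \<notin> beads lam" "x mod int g = int i mod int g"
      by (rule edge_exists)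
    then show ?thesis using beta_eq[of x i] that by simp
  qed
  then show "inj_on (beta g lam) {0..<g}"
    by (intro inj_onI) (metis atLeastLessThan_iff of_nat_eq_iff)
  show "beta g lam ` {0..<g} = ?E"
  proof (intro equalityI subsetI)
    fix x assume x: "x \<in> ?E"
    then have "beta g lam (nat (x mod int g)) = x" using g_pos by (intro beta_eq) auto
    moreover have "nat (x mod int g) \<in> {0..<g}" using g_pos by (simp add: nat_less_iff)
    ultimately show "x \<in> beta g lam ` {0..<g}" by (metis imageI)
  qed (use * in auto)
qed

end

text \<open>The \<open>g\<close> numbers \<open>beta\<close> are the edges: 0, the upper ones, and
  their mirror images, all distinct. Hence \<open>g = 2 * t + 1\<close> leaves exactly
  \<open>t\<close> upper ones.\<close>

lemma V_coding_eq:
  assumes "lam \<in> doubled_distinct_cores g" "g = 2 * t + 1"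
  shows "V_coding g t lam = rev (sorted_list_of_set (upper (int g) (pos_beads lam)))"
    and "card (upper (int g) (pos_beads lam)) = t"
    and "core_beads (int g) (pos_beads lam)"
proof -
  let ?B = "pos_beads lam"
  let ?E = "edge (int g) ?B" and ?U = "upper (int g) ?B"
  have dd: "lam \<in> doubled_distinct" and core: "is_core g lam" and g: "0 < g"
    using assms by (auto simp: doubled_distinct_cores_def)
  show cb: "core_beads (int g) ?B"
    using beads_minus[OF core g] by (simp add: core_beads_def beads_eq_maya[OF dd])
  have E: "beta g lam ` {0..<g} = ?E"
    using beta_image[OF core g] by (simp add: edge_def beads_eq_maya[OF dd])
  have cE: "card ?E = g"
    using card_image[OF beta_inj[OF core g]] E by simp
  have fU: "finite ?U" using finite_upper finite_pos_beads pos_beads_pos by blast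
  have fE: "finite ?E" using finite_edge finite_pos_beads pos_beads_pos by blast
  have "odd (int g)" using assms by simp
  then have EU: "?E = insert 0 (?U \<union> (\<lambda>x. int g - x) ` ?U)"
    using edge_eq_upper[OF pos_beads_pos cb] g by simp
  have U: "int g < 2 * x" if "x \<in> ?U" for x using that by (simp add: upper_def)
  have "0 \<notin> ?U \<union> (\<lambda>x. int g - x) ` ?U"
  proof
    assume "0 \<in> ?U \<union> (\<lambda>x. int g - x) ` ?U"
    then have "int g \<in> ?U" using U[of 0] g by auto
    then show False
      using zero_notin_maya[OF pos_beads_pos] by (auto simp: upper_def edge_def)
  qed
  moreover have "?U \<inter> (\<lambda>x. int g - x) ` ?U = {}"
  proof (rule equals0I)
    fix x assume "x \<in> ?U \<inter> (\<lambda>x. int g - x) ` ?U"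
    then obtain y where "x \<in> ?U" "y \<in> ?U" "x = int g - y" by auto
    then show False using U[of x] U[of y] by simp
  qed
  moreover have "card ((\<lambda>x. int g - x) ` ?U) = card ?U"
    by (rule card_image) (auto simp: inj_on_def)
  ultimately have "card ?E = Suc (card ?U + card ?U)"
    unfolding EU using fU by (simp add: card_Un_disjoint)
  then show cU: "card ?U = t" using cE assms by simp
  \<comment> \<open>The upper edges are the largest, so they form the tail of the sorted list, and
    \<open>take t\<close> after reversal returns precisely them.\<close>
  have "sorted_list_of_set ?E = sorted_list_of_set (?E - ?U) @ sorted_list_of_set ?U"
  proof (rule sorted_distinct_set_unique)
    show "sorted (sorted_list_of_set (?E - ?U) @ sorted_list_of_set ?U)"
      using fE fU by (fastforce simp: sorted_append upper_def)
    show "set (sorted_list_of_set ?E) = set (sorted_list_of_set (?E - ?U) @ sorted_list_of_set ?U)"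
      using fE fU by (auto simp: upper_def)
  qed (use fE fU in auto)
  then show "V_coding g t lam = rev (sorted_list_of_set ?U)"
    using cU by (simp add: V_coding_def E)
qed

section \<open>Explicit products and sums, and the two identities\<close>

lemma pair_prod_enum:
  fixes u :: "nat \<Rightarrow> int" and t :: nat
  assumes "\<And>i j. 1 \<le> i \<Longrightarrow> i < j \<Longrightarrow> j \<le> t \<Longrightarrow> u j < u i"
  shows "pair_prod \<tau> g (u ` {1..t}) =
    (\<Prod>(i, j) \<in> {(i, j). 1 \<le> i \<and> i < j \<and> j \<le> t}. \<tau> (u i - u j) * \<tau> (u i + u j - g))"
proof -
  let ?I = "{(i, j). 1 \<le> i \<and> i < j \<and> j \<le> t}"
  let ?h = "\<lambda>(i, j). (u i, u j)"
  have less: "u j < u i \<longleftrightarrow> i < j" if "i \<in> {1..t}" "j \<in> {1..t}" for i j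
    using assms[of i j] assms[of j i] that by (cases i j rule: linorder_cases) auto
  have inj: "inj_on u {1..t}"
    using less by (intro inj_onI) (metis less_irrefl linorder_neqE_nat)
  have "inj_on ?h ?I"
    by (rule inj_onI) (auto dest: inj_onD[OF inj])
  moreover have "?h ` ?I = {(x, y). x \<in> u ` {1..t} \<and> y \<in> u ` {1..t} \<and> y < x}" (is "_ = ?R")
  proof (intro equalityI subsetI)
    fix p assume "p \<in> ?R"
    then obtain i j where ij: "p = ?h (i, j)" "i \<in> {1..t}" "j \<in> {1..t}" "u j < u i" by auto
    then have "(i, j) \<in> ?I" using less by auto
    then show "p \<in> ?h ` ?I" using ij(1) by blast
  qed (auto simp: less)
  ultimately show ?thesis
    unfolding pair_prod_def \<open>?h ` ?I = ?R\<close>[symmetric]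
    by (subst prod.reindex) (auto intro!: prod.cong)
qed

text \<open>Without positive beads the edges are the numbers from 0 to \<open>g - 1\<close>. In
  \<open>pair_prod\<close> the entries \<open>g - i\<close> and \<open>g - j\<close> produce the
  arguments \<open>j - i\<close> and \<open>g - i - j\<close> of the denominators.\<close>

lemma upper_empty:
  assumes "g = 2 * int t + 1"
  shows "upper g {} = (\<lambda>i. g - int i) ` {1..t}"
proof (rule set_eqI)
  fix x
  have "x \<in> (\<lambda>i. g - int i) ` {1..t} \<longleftrightarrow> nat (g - x) \<in> {1..t} \<and> x < g"
    by (auto intro: image_eqI[of _ _ "nat (g - x)"])
  then show "x \<in> upper g {} \<longleftrightarrow> x \<in> (\<lambda>i. g - int i) ` {1..t}"
    using assms by (auto simp: upper_def edge_def maya_def)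
qed

lemma sum_odd_squares: "3 * (\<Sum>j<t. (2 * int j + 1)\<^sup>2) = int t * (2 * int t - 1) * (2 * int t + 1)"
  by (induction t) (simp_all add: power2_eq_square algebra_simps)

lemma upper_empty_square_sum:
  assumes "g = 2 * int t + 1"
  shows "3 * (\<Sum>x\<in>upper g {}. (2 * x - g)\<^sup>2) = int t * (g - 2) * g"
proof -
  have "(\<Sum>x\<in>upper g {}. (2 * x - g)\<^sup>2) = (\<Sum>i\<in>{1..t}. (g - 2 * int i)\<^sup>2)"
    unfolding upper_empty[OF assms] by (subst sum.reindex) (auto simp: inj_on_def algebra_simps)
  also have "\<dots> = (\<Sum>j<t. (2 * int j + 1)\<^sup>2)"
    by (rule sum.reindex_bij_witness[of _ "\<lambda>j. t - j" "\<lambda>i. t - i"])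
      (auto simp: assms of_nat_diff algebra_simps)
  finally show ?thesis using sum_odd_squares[of t] assms by (simp add: algebra_simps)
qed

text \<open>Each exponent counts beads, so the power is a product of indicator factors over beads;
  exchanging the two products groups them by bead.\<close>

lemma alpha_prod:
  fixes \<tau> :: "int \<Rightarrow> 'a :: field"
  assumes "lam \<in> doubled_distinct"
  shows "(\<Prod>i = 1..g - 1. (\<tau> (- int i) / \<tau> (int i)) ^ alpha g lam i) =
    (\<Prod>b\<in>pos_beads lam. \<Prod>i \<in> {i \<in> {1..int g - 1}. b - int g + i \<in> row (pos_beads lam) b}.
      \<tau> (- i) / \<tau> i)"
proof -
  let ?B = "pos_beads lam"
  let ?c = "\<lambda>b i. if b - int g + i \<in> row ?B b then \<tau> (- i) / \<tau> i else 1"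
  have "(\<tau> (- int i) / \<tau> (int i)) ^ alpha g lam i = (\<Prod>b\<in>?B. ?c b (int i))"
    if "i \<in> {1..g - 1}" for i
    using that by (subst alpha_doubled_distinct[OF assms])
      (auto simp: power_sum intro!: prod.cong)
  then have "(\<Prod>i = 1..g - 1. (\<tau> (- int i) / \<tau> (int i)) ^ alpha g lam i) =
      (\<Prod>i = 1..g - 1. \<Prod>b\<in>?B. ?c b (int i))"
    by (intro prod.cong) auto
  also have "\<dots> = (\<Prod>b\<in>?B. \<Prod>i = 1..g - 1. ?c b (int i))" by (rule prod.swap)
  also have "\<dots> = (\<Prod>b\<in>?B. \<Prod>i\<in>{1..int g - 1}. ?c b i)"
    by (intro prod.cong refl prod.reindex_bij_witness[of _ nat int]) auto
  also have "\<dots> = (\<Prod>b\<in>?B. \<Prod>i \<in> {i \<in> {1..int g - 1}. b - int g + i \<in> row ?B b}. \<tau> (- i) / \<tau> i)"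
    by (intro prod.cong refl prod.inter_filter[symmetric]) simp
  finally show ?thesis .
qed

theorem theorem4p25:
  fixes t g :: nat and \<omega> :: "nat list" and v :: "int list" and r :: "nat \<Rightarrow> real"
  assumes "t \<ge> 1"
    and "g = 2 * t + 1"
    and "\<omega> \<in> doubled_distinct_cores g"
    and "v = V_coding g t \<omega>"
    and "\<forall>i \<in> {1..t}. r i = real_of_int (v ! (i - 1)) - real g / 2"
  shows "real (sum_list \<omega>) =
      1 / real g * (\<Sum>i = 1..t. (r i)\<^sup>2) - (real g - 2) * real_of_int \<lfloor>real g / 2\<rfloor> / 12
    \<and> (\<forall>\<tau> :: int \<Rightarrow> 'a :: field. (\<forall>k. \<tau> k \<noteq> 0) \<longrightarrow>
        (\<Prod>s \<in> boxes \<omega>. \<tau> (hook \<omega> s - eps s * int g) / \<tau> (hook \<omega> s)) =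
        (\<Prod>i = 1..g - 1. (\<tau> (- int i) / \<tau> (int i)) ^ alpha g \<omega> i) *
        (\<Prod>(i, j) \<in> {(i, j). 1 \<le> i \<and> i < j \<and> j \<le> t}.
           at_int \<tau> (r i - r j) / \<tau> (int j - int i) *
           (at_int \<tau> (r i + r j) / \<tau> (int g - int i - int j))))"
proof -
  define B where "B = pos_beads \<omega>"
  define U where "U = upper (int g) B"
  define u where "u i = v ! (i - 1)" for i
  have dd: "\<omega> \<in> doubled_distinct" using assms(3) by (simp add: doubled_distinct_cores_def)
  have B: "finite B" "B \<subseteq> {0<..}" using finite_pos_beads pos_beads_pos by (auto simp: B_def)
  note coding = V_coding_eq[OF assms(3,2), folded B_def, folded U_def]
  have v: "v = rev (sorted_list_of_set U)" "length v = t"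
    using coding assms(4) by simp_all
  have fU: "finite U" using finite_upper[OF B] by (simp add: U_def)
  have u_less: "u j < u i" if "1 \<le> i" "i < j" "j \<le> t" for i j
  proof -
    have "sorted_wrt (>) v"
      unfolding v(1) sorted_wrt_rev using strict_sorted_list_of_set by simp
    then show ?thesis
      using that v(2) by (auto simp: u_def intro!: sorted_wrt_nth_less[of "(>)" v])
  qed
  have uU: "u ` {1..t} = U"
  proof -
    have "u ` {1..t} = (!) v ` {0..<t}"
    proof (intro equalityI subsetI)
      fix x assume "x \<in> (!) v ` {0..<t}"
      then obtain i where "i < t" "x = v ! i" by auto
      then show "x \<in> u ` {1..t}" by (intro image_eqI[of _ _ "Suc i"]) (auto simp: u_def)
    qed (auto simp: u_def)
    also have "\<dots> = set v" using v(2) by (metis list.set_map map_nth set_upt)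
    finally show ?thesis using v(1) fU by simp
  qed
  have u_inj: "inj_on u {1..t}"
    using u_less by (intro inj_onI) (metis atLeastAtMost_iff less_irrefl linorder_neqE_nat)
  have r: "r i = real_of_int (u i) - real g / 2" if "i \<in> {1..t}" for i
    using assms(5) that by (simp add: u_def)
  have godd: "odd (int g)" "0 < int g" and g: "int g = 2 * int t + 1" using assms(2) by simp_all

  have "real (sum_list \<omega>) =
      1 / real g * (\<Sum>i = 1..t. (r i)\<^sup>2) - (real g - 2) * real_of_int \<lfloor>real g / 2\<rfloor> / 12"
  proof -
    define Q where "Q = (\<Sum>x\<in>U. (2 * x - int g)\<^sup>2)"
    \<comment> \<open>The size is twice the sum of the positive beads, so three times the increment
      \<open>8 * g * \<Sum>B\<close> is \<open>12 * g\<close> times the size. The term with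
      \<open>t * (g - 2) * g\<close> is the empty core and becomes the subtracted constant.\<close>
    have "3 * Q = int t * (int g - 2) * int g + 12 * int g * int (sum_list \<omega>)"
      using beads_square_sum[OF B coding(3) godd(2,1)] upper_empty_square_sum[OF g]
        size_doubled_distinct[OF dd]
      by (simp add: Q_def U_def B_def algebra_simps)
    from arg_cong[OF this, of real_of_int]
    have Q: "3 * real_of_int Q = real t * (real g - 2) * real g + 12 * real g * real (sum_list \<omega>)"
      by simp
    have "(\<Sum>i = 1..t. (r i)\<^sup>2) = (\<Sum>i = 1..t. real_of_int ((2 * u i - int g)\<^sup>2) / 4)"
      by (rule sum.cong) (simp_all add: r power2_eq_square field_simps)
    also have "\<dots> = real_of_int Q / 4"
      unfolding Q_def uU[symmetric] sum.reindex[OF u_inj] by (simp add: sum_divide_distrib)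
    finally have R: "(\<Sum>i = 1..t. (r i)\<^sup>2) = real_of_int Q / 4" .
    have "\<lfloor>real g / 2\<rfloor> = int t" using assms(2) by (intro floor_unique) auto
    then show ?thesis
      unfolding R using Q godd(2) by (simp add: field_simps)
  qed
  moreover have "(\<Prod>s \<in> boxes \<omega>. \<tau> (hook \<omega> s - eps s * int g) / \<tau> (hook \<omega> s)) =
        (\<Prod>i = 1..g - 1. (\<tau> (- int i) / \<tau> (int i)) ^ alpha g \<omega> i) *
        (\<Prod>(i, j) \<in> {(i, j). 1 \<le> i \<and> i < j \<and> j \<le> t}.
           at_int \<tau> (r i - r j) / \<tau> (int j - int i) *
           (at_int \<tau> (r i + r j) / \<tau> (int g - int i - int j)))"
    if nz: "\<forall>k. \<tau> k \<noteq> 0" for \<tau> :: "int \<Rightarrow> 'a"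
  proof -
    let ?I = "{(i, j). 1 \<le> i \<and> i < j \<and> j \<le> t}"
    have fI: "finite ?I" by (rule finite_subset[of _ "{1..t} \<times> {1..t}"]) auto
    let ?L = "\<Prod>s \<in> boxes \<omega>. \<tau> (hook \<omega> s - eps s * int g) / \<tau> (hook \<omega> s)"
    let ?A = "\<Prod>i = 1..g - 1. (\<tau> (- int i) / \<tau> (int i)) ^ alpha g \<omega> i"
    have L: "?L = (\<Prod>b\<in>B. (\<Prod>a \<in> row B b. \<tau> (b - a - int g) / \<tau> (b - a)) *
        (\<Prod>a \<in> row B b - {0, - b}. \<tau> (b - a + int g) / \<tau> (b - a)))"
      using prod.boxes_doubled_distinct[OF dd B_def, of "\<lambda>h e. \<tau> (h - e * int g) / \<tau> h"] by simp
    have key: "?L * pair_prod \<tau> (int g) (upper (int g) {}) = ?A * pair_prod \<tau> (int g) U"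
      unfolding L alpha_prod[OF dd] B_def[symmetric] U_def
      using nz by (intro beads_prod[OF B coding(3) godd(2,1)]) simp
    have P0: "pair_prod \<tau> (int g) (upper (int g) {}) =
        (\<Prod>(i, j) \<in> ?I. \<tau> (int j - int i) * \<tau> (int g - int i - int j))"
      unfolding upper_empty[OF g]
      by (subst pair_prod_enum) (auto intro!: prod.cong simp: algebra_simps)
    have P: "pair_prod \<tau> (int g) U = (\<Prod>(i, j) \<in> ?I. at_int \<tau> (r i - r j) * at_int \<tau> (r i + r j))"
    proof -
      have at: "at_int \<tau> (r i - r j) = \<tau> (u i - u j)"
          "at_int \<tau> (r i + r j) = \<tau> (u i + u j - int g)" if "(i, j) \<in> ?I" for i j
      proof -
        have "i \<in> {1..t}" "j \<in> {1..t}" using that by auto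
        then show "at_int \<tau> (r i - r j) = \<tau> (u i - u j)"
          "at_int \<tau> (r i + r j) = \<tau> (u i + u j - int g)"
          by (simp_all only: r at_int_simps)
      qed
      have "pair_prod \<tau> (int g) U = (\<Prod>(i, j) \<in> ?I. \<tau> (u i - u j) * \<tau> (u i + u j - int g))"
        unfolding uU[symmetric] by (rule pair_prod_enum) (rule u_less)
      also have "\<dots> = (\<Prod>(i, j) \<in> ?I. at_int \<tau> (r i - r j) * at_int \<tau> (r i + r j))"
        by (rule prod.cong) (auto simp: at)
      finally show ?thesis .
    qed
    \<comment> \<open>As \<open>\<tau>\<close> never vanishes, the product for the empty core can be
      moved to the denominator.\<close>
    have "pair_prod \<tau> (int g) (upper (int g) {}) \<noteq> 0"
      unfolding P0 using fI nz by (auto simp: prod_zero_iff)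
    with key have "?L = ?A * (pair_prod \<tau> (int g) U / pair_prod \<tau> (int g) (upper (int g) {}))"
      by (simp add: field_simps)
    also have "pair_prod \<tau> (int g) U / pair_prod \<tau> (int g) (upper (int g) {}) =
        (\<Prod>(i, j) \<in> ?I. at_int \<tau> (r i - r j) / \<tau> (int j - int i) *
           (at_int \<tau> (r i + r j) / \<tau> (int g - int i - int j)))"
      unfolding P P0 prod_dividef[symmetric] by (rule prod.cong) auto
    finally show ?thesis .
  qed
  ultimately show ?thesis by blast
qed

end
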